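(* Consider the generalized Riemann problem for the 1D ten-moment equations with source, nonsonic case, and assume that the 1-rarefaction wave associated with $u_1-c$ moves to the left. Then, with the coefficients defined in the context, $$\left(\tfrac{\mathcal D u_2}{\mathcal D t}\right)_{\ast L}=\frac{d_{3,L}b_{4,L}-d_{4,L}b_{3,L}}{a_{3,L}b_{4,L}-a_{4,L}b_{3,L}},\qquad \left(\tfrac{\mathcal D p_{12}}{\mathcal D t}\right)_{\ast L}=\frac{d_{3,L}a_{4,L}-d_{4,L}a_{3,L}}{b_{3,L}a_{4,L}-b_{4,L}a_{3,L}},$$ and $$\left(\tfrac{\partial u_2}{\partial t}\right)_{\ast L}=\left(\tfrac{\mathcal D u_2}{\mathcal D t}\right)_{\ast L}+\frac{u_{1,\ast}}{p_{11,\ast}}\left[\left(\tfrac{\mathcal D p_{12}}{\mathcal D t}\right)_{\ast L}-\frac{2p_{12,\ast L}}{3p_{11,\ast}}\left(\tfrac{\mathcal D p_{11}}{\mathcal D t}\right)_\ast\right],$$ $$\left(\tfrac{\partial p_{12}}{\partial t}\right)_{\ast L}=\left(\tfrac{\mathcal D p_{12}}{\mathcal D t}\right)_{\ast L}+\rho_{\ast L}u_{1,\ast}\left(\tfrac{\mathcal D u_2}{\mathcal D t}\right)_{\ast L}.$$ The limiting value $\left(\frac{\partial p_{22}}{\partial t}\right)_{\ast L}$ can be obtained from $$\left(\tfrac{p_{11}}{\rho^4}\tfrac{\partial p_{22}}{\partial t}\right)_{\ast L}=-\frac{S_{2,L}'}{c_L}c_{\ast L}u_{1,\ast}-\left(\tfrac{p_{22}}{\rho^4}\tfrac{\partial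 p_{11}}{\partial t}\right)_{\ast L}+\left(\tfrac{2p_{12}}{\rho^4}\tfrac{\partial p_{12}}{\partial t}\right)_{\ast L}+\left(\tfrac{4\det(\mathbf p)}{\rho^5}\tfrac{\partial\rho}{\partial t}\right)_{\ast L}.$$
   Context: **System.** $\mathbf V=(\rho,u_1,u_2,p_{11},p_{12},p_{22})^\top$ with $\rho>0$, $p_{11}>0$, $\det(\mathbf p)=p_{11}p_{22}-p_{12}^2>0$; $W(x)$ is a given $C^1$ potential; $c=\sqrt{3p_{11}/\rho}$; $\frac{\mathcal D}{\mathcal D t}=\partial_t+u_1\partial_x$. Smooth solutions satisfy: $\frac{\mathcal D\rho}{\mathcal D t}+\rho\partial_xu_1=0$; $\frac{\mathcal D u_1}{\mathcal D t}+\frac1\rho\partial_xp_{11}=-\frac12W_x$; $\frac{\mathcal D u_2}{\mathcal D t}+\frac1\rho\partial_xp_{12}=0$; $\frac{\mathcal D p_{11}}{\mathcal D t}+3p_{11}\partial_xu_1=0$; $\frac{\mathcal D p_{12}}{\mathcal D t}+2p_{12}\partial_xu_1+p_{11}\partial_xu_2=0$; $\frac{\mathcal D p_{22}}{\mathcal D t}+p_{22}\partial_xu_1+2p_{12}\partial_xu_2=0$. **Generalized Riemann problem.** Initial data $\mathbf V_L+x\mathbf V_L'$ for $x<0$, $\mathbf V_R+x\mathbf V_R'$ for $x>0$, with constant vectors $\mathbf V_K=(\rho_K,u_{1,K},u_{2,K},p_{11,K},p_{12,K},p_{22,K})^\top$ and $\mathbf V_K'=(\rho_K',\dots,p_{22,K}')^\top$.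 Near $(0,0)$, $0<t\ll1$, the solution is piecewise smooth, and the leftmost wave is a 1-rarefaction (field $u_1-c$) followed on its right by a region $\ast L$ (bounded on the right by the 2-shear wave of speed $u_1-c/\sqrt3$). Left of the fan and in $\ast L$, $\mathbf V$ and its first derivatives have limits at $(0,0)$; subscript $\ast L$ on an expression denotes its limit from $\ast L$. The limiting state there is $\mathbf V_{\ast L}=(\rho_{\ast L},u_{1,\ast},u_{2,\ast L},p_{11,\ast},p_{12,\ast L},p_{22,\ast L})^\top$, $c_{\ast L}=\sqrt{3p_{11,\ast}/\rho_{\ast L}}$; $(\frac{\mathcal D u_1}{\mathcal D t})_\ast,(\frac{\mathcal D p_{11}}{\mathcal D t})_\ast$ denote the limits there (they are common to all regions between the 1-wave and the 6-wave). Nonsonic: the $t$-axis lies between the 1-wave and the 6-wave. $\mathbf V$ is continuous across head and tail of the fan. **Fan.** The fan is parametrized by characteristic coordinates $(\alpha,\beta)$, $-\alpha_0\le\alpha\le0$, $\beta_L\le\beta\le\beta_{\ast L}$, $\beta_L=u_{1,L}-c_L$, $\beta_{\ast L}=u_{1,\ast}-c_{\ast L}$: curves $\beta=$ const are integral curves of $dx/dt=u_1-c$ leaving the origin with slope $\beta$, curves $\alpha=$ const are integral curves of $dx/dt=u_1+c$, $\alpha=0$ is the origin; $x,t,\mathbf V$ are smooth functions of $(\alpha,\beta)$ and $\partial t/\partial\alpha\neq0$. The 1-Riemann invariants $\psi_1=u_1+c$, $S_1=p_{11}/\rho^3$, $\psi_2=u_2+\frac{\sqrt3p_{12}}{\sqrt{\rho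 p_{11}}}$, $\psi_3=\frac{p_{12}}{\rho^3}$, $S_2=\frac{\det(\mathbf p)}{\rho^4}$ and their first $x$-, $t$-derivatives are continuous in $(\alpha,\beta)$ up to $\alpha=0$ (where the invariants equal their $\mathbf V_L$ values), and their first derivatives are continuous across the tail of the fan. **Left data.** $c_L=\sqrt{3p_{11,L}/\rho_L}$, $\psi_{1,L}=u_{1,L}+c_L$, $S_{1,L}'=\frac1{\rho_L^3}(p_{11,L}'-c_L^2\rho_L')$, $\psi_{2,L}'=u_{2,L}'+\frac{\sqrt3}{\sqrt{\rho_Lp_{11,L}}}p_{12,L}'-\frac{\sqrt3p_{12,L}}{2\rho_L\sqrt{\rho_Lp_{11,L}}}\rho_L'-\frac{\sqrt3p_{12,L}}{2p_{11,L}\sqrt{\rho_Lp_{11,L}}}p_{11,L}'$, $\psi_{3,L}'=\frac{p_{12,L}'}{\rho_L^3}-\frac{3p_{12,L}}{\rho_L^4}\rho_L'$, $S_{2,L}'=\frac{p_{11,L}}{\rho_L^4}p_{22,L}'+\frac{p_{22,L}}{\rho_L^4}p_{11,L}'-\frac{2p_{12,L}}{\rho_L^4}p_{12,L}'-\frac{4\det(\mathbf p_L)}{\rho_L^5}\rho_L'$, $\Pi_{2,L}=\frac2{\rho_L}p_{12,L}'-\frac{3p_{12,L}}{2\rho_L^2}\rho_L'-\frac{3p_{12,L}}{2\rho_Lp_{11,L}}p_{11,L}'$, $\Pi_{3,L}=\frac{c_L}{\rho_L^3}p_{12,L}'+\frac{p_{12,L}}{\rho_L^3}u_{1,L}'-\frac{p_{11,L}}{\rho_L^3}u_{2,L}'-\frac{3p_{12,L}c_L}{\rho_L^4}\rho_L'$,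 $\kappa_k:=\frac1{2c_L}(\Pi_{k,L}-2c_L\psi_{k,L}')$ for $k=2,3$ (the values of $\partial\psi_k/\partial\alpha$ at $(0,\beta_L)$ in the paper's normalization $\frac{\partial t}{\partial\alpha}(0,\beta)=\frac1{2c(0,\beta)}$). **Quadrature convention.** Let $\Pi_2:=\frac2\rho\partial_xp_{12}-\frac{3p_{12}}{2\rho^2}\partial_x\rho-\frac{3p_{12}}{2\rho p_{11}}\partial_xp_{11}$ and $\Pi_3:=\frac c{\rho^3}\partial_xp_{12}+\frac{p_{12}}{\rho^3}\partial_xu_1-\frac{p_{11}}{\rho^3}\partial_xu_2-\frac{3p_{12}c}{\rho^4}\partial_x\rho$ (so $\partial_t\psi_k+(u_1+c)\partial_x\psi_k=\Pi_k$). The paper evaluates the integral over $[\beta_L,\beta]$ occurring in $\frac{\partial\psi_k}{\partial\alpha}(0,\beta)$ by a trapezoidal rule, i.e. it takes, for $k=2,3$, $$\left(\tfrac{\partial\psi_k}{\partial t}\right)_{\ast L}=\left[\kappa_k+\frac{\Pi_{k,L}}{8c_L}(\beta_{\ast L}-\beta_L)\right]\psi_{1,L}+\frac{q}{2c_{\ast L}}(\Pi_k)_{\ast L},\qquad q:=\frac{\beta_{\ast L}-\beta_L}4\psi_{1,L}-\beta_{\ast L}.$$ This relation is assumed. **Coefficients.** $a_{3,L}=1+\frac{\sqrt3\rho_{\ast L}u_{1,\ast}}{\sqrt{\rho_{\ast L}p_{11,\ast}}}+\frac q{c_{\ast L}}$, $b_{3,L}=\frac{u_{1,\ast}}{p_{11,\ast}}+\frac{\sqrt3}{\sqrt{\rho_{\ast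 L}p_{11,\ast}}}$, $d_{3,L}=\left[\kappa_2+\frac{\Pi_{2,L}}{8c_L}(\beta_{\ast L}-\beta_L)\right]\psi_{1,L}+\frac q{2c_{\ast L}}\left\{\frac{2p_{12,\ast L}}{p_{11,\ast}}\left[(\frac{\mathcal D u_1}{\mathcal D t})_\ast+\frac12W_x(0)\right]+\frac{S_{1,L}'}{c_L}\frac{c_{\ast L}\rho_{\ast L}^2p_{12,\ast L}}{2p_{11,\ast}}\right\}+\frac{\sqrt3p_{12,\ast L}}{2\rho_{\ast L}\sqrt{\rho_{\ast L}p_{11,\ast}}}(\frac{\partial\rho}{\partial t})_{\ast L}+\frac{\sqrt3p_{12,\ast L}}{2p_{11,\ast}\sqrt{\rho_{\ast L}p_{11,\ast}}}(\frac{\partial p_{11}}{\partial t})_{\ast L}+\frac{2u_{1,\ast}p_{12,\ast L}}{3p_{11,\ast}^2}(\frac{\mathcal D p_{11}}{\mathcal D t})_\ast$; $a_{4,L}=\frac1{\rho_{\ast L}^2}\left[u_{1,\ast}+\frac q2\right]$, $b_{4,L}=\frac1{\rho_{\ast L}^3}\left[1-\frac q{2c_{\ast L}}\right]$, $d_{4,L}=\left[\kappa_3+\frac{\Pi_{3,L}}{8c_L}(\beta_{\ast L}-\beta_L)\right]\psi_{1,L}+\frac{3p_{12,\ast L}}{\rho_{\ast L}^4}(\frac{\partial\rho}{\partial t})_{\ast L}+\frac q{2c_{\ast L}}\left\{\frac1{\rho_{\ast L}^3}\left[-\frac{p_{12,\ast L}}{p_{11,\ast}}(\frac{\mathcal D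 p_{11}}{\mathcal D t})_\ast+\frac{3p_{12,\ast L}}{c_{\ast L}}\left((\frac{\mathcal D u_1}{\mathcal D t})_\ast+\frac12W_x(0)\right)\right]+\frac{S_{1,L}'}{c_L}\frac{3p_{12,\ast L}}{\rho_{\ast L}}\right\}$. The quotients are understood with $a_{3,L}b_{4,L}-a_{4,L}b_{3,L}\ne0$. *)

theory Defs
  imports "HOL-Analysis.Analysis"
begin

section \<open>States of the one-dimensional ten-moment system\<close>

type_synonym state = "real ^ 6"

abbreviation rho :: "state \<Rightarrow> real" where "rho v \<equiv> v $ 1"
abbreviation u1 :: "state \<Rightarrow> real" where "u1 v \<equiv> v $ 2"
abbreviation u2 :: "state \<Rightarrow> real" where "u2 v \<equiv> v $ 3"
abbreviation p11 :: "state \<Rightarrow> real" where "p11 v \<equiv> v $ 4"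
abbreviation p12 :: "state \<Rightarrow> real" where "p12 v \<equiv> v $ 5"
abbreviation p22 :: "state \<Rightarrow> real" where "p22 v \<equiv> v $ 6"

definition detp :: "state \<Rightarrow> real" where
  "detp v = p11 v * p22 v - (p12 v)\<^sup>2"

definition admissible :: "state \<Rightarrow> bool" where
  "admissible v \<longleftrightarrow> rho v > 0 \<and> p11 v > 0 \<and> detp v > 0"

definition sound :: "state \<Rightarrow> real" where
  "sound v = sqrt (3 * p11 v / rho v)"

definition lam1 :: "state \<Rightarrow> real" where
  "lam1 v = u1 v - sound v"

text \<open>The 1-Riemann invariants.\<close>

definition psi1 :: "state \<Rightarrow> real" where
  "psi1 v = u1 v + sound v"

definition S1 :: "state \<Rightarrow> real" where
  "S1 v = p11 v / rho v ^ 3"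

definition psi2 :: "state \<Rightarrow> real" where
  "psi2 v = u2 v + sqrt 3 * p12 v / sqrt (rho v * p11 v)"

definition psi3 :: "state \<Rightarrow> real" where
  "psi3 v = p12 v / rho v ^ 3"

definition S2 :: "state \<Rightarrow> real" where
  "S2 v = detp v / rho v ^ 4"


section \<open>Calculus in the plane\<close>

text \<open>Partial derivatives with respect to the first and second coordinate.
  Points of the physical plane are written \<open>(x, t)\<close>, points of the characteristic
  plane \<open>(\<alpha>, \<beta>)\<close>; thus \<open>pd1\<close> is \<open>\<partial>/\<partial>x\<close> or \<open>\<partial>/\<partial>\<alpha>\<close>,
  and \<open>pd2\<close> is \<open>\<partial>/\<partial>t\<close> or \<open>\<partial>/\<partial>\<beta>\<close>.\<close>

definition pd1 :: "(real \<times> real \<Rightarrow> 'a::real_normed_vector) \<Rightarrow> real \<times> real \<Rightarrow> 'a" where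
  "pd1 f z = vector_derivative (\<lambda>s. f (s, snd z)) (at (fst z))"

definition pd2 :: "(real \<times> real \<Rightarrow> 'a::real_normed_vector) \<Rightarrow> real \<times> real \<Rightarrow> 'a" where
  "pd2 f z = vector_derivative (\<lambda>s. f (fst z, s)) (at (snd z))"

text \<open>These two notions are only used on open sets.\<close>

definition C1_on :: "(real \<times> real \<Rightarrow> 'a::real_normed_vector) \<Rightarrow> (real \<times> real) set \<Rightarrow> bool" where
  "C1_on f S \<longleftrightarrow> f differentiable_on S \<and> continuous_on S (pd1 f) \<and> continuous_on S (pd2 f)"

definition C2_on :: "(real \<times> real \<Rightarrow> 'a::real_normed_vector) \<Rightarrow> (real \<times> real) set \<Rightarrow> bool" where
  "C2_on f S \<longleftrightarrow> C1_on f S \<and> C1_on (pd1 f) S \<and> C1_on (pd2 f) S"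

definition wave_region :: "real \<Rightarrow> (real \<Rightarrow> real) \<Rightarrow> (real \<Rightarrow> real) \<Rightarrow> (real \<times> real) set" where
  "wave_region T f g = {(x, t). 0 < t \<and> t < T \<and> f t < x \<and> x < g t}"

definition lim0 :: "(real \<times> real) set \<Rightarrow> (real \<times> real \<Rightarrow> 'a::t2_space) \<Rightarrow> 'a" where
  "lim0 S f = Lim (at (0, 0) within S) f"

definition has_limits_at_origin :: "(real \<times> real \<Rightarrow> state) \<Rightarrow> (real \<times> real) set \<Rightarrow> bool" where
  "has_limits_at_origin V S \<longleftrightarrow>
     (\<exists>A. (V \<longlongrightarrow> A) (at (0, 0) within S)) \<and>
     (\<exists>B. (pd1 V \<longlongrightarrow> B) (at (0, 0) within S)) \<and>
     (\<exists>C. (pd2 V \<longlongrightarrow> C) (at (0, 0) within S))"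


section \<open>The system\<close>

definition material :: "(real \<times> real \<Rightarrow> state) \<Rightarrow> (real \<times> real \<Rightarrow> real) \<Rightarrow> real \<times> real \<Rightarrow> real" where
  "material V f z = pd2 f z + u1 (V z) * pd1 f z"

definition ten_moment_at :: "(real \<Rightarrow> real) \<Rightarrow> (real \<times> real \<Rightarrow> state) \<Rightarrow> real \<times> real \<Rightarrow> bool" where
  "ten_moment_at W V z \<longleftrightarrow>
     (let \<rho> = (\<lambda>y. rho (V y)); v1 = (\<lambda>y. u1 (V y)); v2 = (\<lambda>y. u2 (V y));
          q11 = (\<lambda>y. p11 (V y)); q12 = (\<lambda>y. p12 (V y)); q22 = (\<lambda>y. p22 (V y))
      in material V \<rho> z + \<rho> z * pd1 v1 z = 0 \<and>
         material V v1 z + 1 / \<rho> z * pd1 q11 z = - 1 / 2 * deriv W (fst z) \<and>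
         material V v2 z + 1 / \<rho> z * pd1 q12 z = 0 \<and>
         material V q11 z + 3 * q11 z * pd1 v1 z = 0 \<and>
         material V q12 z + 2 * q12 z * pd1 v1 z + q11 z * pd1 v2 z = 0 \<and>
         material V q22 z + q22 z * pd1 v1 z + 2 * q12 z * pd1 v2 z = 0)"

definition smooth_solution :: "(real \<Rightarrow> real) \<Rightarrow> (real \<times> real \<Rightarrow> state) \<Rightarrow> (real \<times> real) set \<Rightarrow> bool" where
  "smooth_solution W V S \<longleftrightarrow> C1_on V S \<and> (\<forall>z\<in>S. admissible (V z) \<and> ten_moment_at W V z)"


section \<open>The generalized Riemann problem\<close>

text \<open>A piecewise smooth solution on \<open>-r < x < r\<close>, \<open>0 \<le> t < T\<close>. All curves are graphs
  \<open>x = f t\<close> issuing from the origin: \<open>\<eta>\<close> and \<open>\<gamma> 0\<close> are the head and the tail of the 1-wave,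
  \<open>\<gamma> 1\<close> is the 2-shear wave, \<open>\<gamma> 2, \<dots>, \<gamma> (n - 1)\<close> are the further waves between the 1-wave
  and the 6-wave, and \<open>\<gamma> n\<close>, \<open>\<zeta>\<close> are the left and right edges of the 6-wave
  (they coincide if the 6-wave is a shock). The region \<open>*L\<close> is \<open>wave_region T (\<gamma> 0) (\<gamma> 1)\<close>.
  Jump relations across \<open>\<gamma> 1, \<dots>, \<gamma> n, \<zeta>\<close> are not imposed.\<close>

locale grp_solution =
  fixes W :: "real \<Rightarrow> real"
    and V :: "real \<times> real \<Rightarrow> state"
    and VL VL' VR VR' :: state
    and r T :: real
    and n :: nat
    and \<eta> :: "real \<Rightarrow> real"
    and \<gamma> :: "nat \<Rightarrow> real \<Rightarrow> real"
    and \<zeta> :: "real \<Rightarrow> real"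
  assumes potential: "W C1_differentiable_on UNIV"
    and states: "admissible VL" "admissible VR"
    and domain: "r > 0" "T > 0"
    and waves: "n \<ge> 2"
    and curves_continuous:
      "continuous_on {0..<T} \<eta>" "\<And>i. i \<le> n \<Longrightarrow> continuous_on {0..<T} (\<gamma> i)"
      "continuous_on {0..<T} \<zeta>"
    and curves_origin: "\<eta> 0 = 0" "\<And>i. i \<le> n \<Longrightarrow> \<gamma> i 0 = 0" "\<zeta> 0 = 0"
    and curves_ordered:
      "\<And>t. 0 < t \<Longrightarrow> t < T \<Longrightarrow> - r < \<eta> t \<and> \<eta> t < \<gamma> 0 t"
      "\<And>t i. 0 < t \<Longrightarrow> t < T \<Longrightarrow> i < n \<Longrightarrow> \<gamma> i t < \<gamma> (Suc i) t"
      "\<And>t. 0 < t \<Longrightarrow> t < T \<Longrightarrow> \<gamma> n t \<le> \<zeta> t \<and> \<zeta> t < r"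
    and initial_left:
      "\<And>x. - r < x \<Longrightarrow> x < 0 \<Longrightarrow> V (x, 0) = VL + x *\<^sub>R VL'"
      "continuous_on (wave_region T (\<lambda>_. - r) \<eta> \<union> {- r<..<0} \<times> {0}) V"
    and initial_right:
      "\<And>x. 0 < x \<Longrightarrow> x < r \<Longrightarrow> V (x, 0) = VR + x *\<^sub>R VR'"
      "continuous_on (wave_region T \<zeta> (\<lambda>_. r) \<union> {0<..<r} \<times> {0}) V"
    and smooth:
      "smooth_solution W V (wave_region T (\<lambda>_. - r) \<eta>)"
      "smooth_solution W V (wave_region T \<eta> (\<gamma> 0))"
      "\<And>i. i < n \<Longrightarrow> smooth_solution W V (wave_region T (\<gamma> i) (\<gamma> (Suc i)))"
      "smooth_solution W V (wave_region T (\<gamma> n) \<zeta>)"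
      "smooth_solution W V (wave_region T \<zeta> (\<lambda>_. r))"
    and limits:
      "has_limits_at_origin V (wave_region T (\<lambda>_. - r) \<eta>)"
      "has_limits_at_origin V (wave_region T (\<gamma> 0) (\<gamma> 1))"
    and limit_state: "admissible (lim0 (wave_region T (\<gamma> 0) (\<gamma> 1)) V)"
    and common_limits:
      "\<And>i. i < n \<Longrightarrow>
         (material V (\<lambda>y. u1 (V y)) \<longlongrightarrow>
            lim0 (wave_region T (\<gamma> 0) (\<gamma> 1)) (material V (\<lambda>y. u1 (V y))))
           (at (0, 0) within wave_region T (\<gamma> i) (\<gamma> (Suc i)))"
      "\<And>i. i < n \<Longrightarrow>
         (material V (\<lambda>y. p11 (V y)) \<longlongrightarrow>
            lim0 (wave_region T (\<gamma> 0) (\<gamma> 1)) (material V (\<lambda>y. p11 (V y))))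
           (at (0, 0) within wave_region T (\<gamma> i) (\<gamma> (Suc i)))"
    and shear_speed:
      "\<And>t. 0 \<le> t \<Longrightarrow> t < T \<Longrightarrow>
         \<exists>s. ((\<lambda>z. u1 (V z) - sound (V z) / sqrt 3) \<longlongrightarrow> s)
               (at (\<gamma> 1 t, t) within wave_region T (\<gamma> 0) (\<gamma> 1)) \<and>
             (\<gamma> 1 has_real_derivative s) (at t within {0..})"


text \<open>The 1-wave is a rarefaction: the part of the plane between \<open>\<eta>\<close> and \<open>\<gamma>0\<close> is
  parametrized by characteristic coordinates \<open>(\<alpha>, \<beta>)\<close> through \<open>x = X (\<alpha>, \<beta>)\<close>,
  \<open>t = Y (\<alpha>, \<beta>)\<close>, and \<open>F\<close> is the solution in these coordinates. Smoothness on the closed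
  rectangle means that \<open>X\<close>, \<open>Y\<close>, \<open>F\<close> are C2 on an open neighbourhood of it (their values
  outside the rectangle are irrelevant), so that \<open>pd1\<close>, \<open>pd2\<close> make sense also on its edges.
  No normalization of \<open>\<partial>t/\<partial>\<alpha>\<close> is imposed; as \<open>\<alpha> \<le> 0\<close> and \<open>t \<ge> 0\<close>, its sign at
  \<open>\<alpha> = 0\<close> is negative.\<close>

locale rarefaction_fan =
  fixes V :: "real \<times> real \<Rightarrow> state"
    and VL :: state
    and \<beta>L \<beta>s r T :: real
    and \<eta> \<gamma>0 \<gamma>1 :: "real \<Rightarrow> real"
    and \<alpha>0 :: real
    and X Y :: "real \<times> real \<Rightarrow> real"
    and F :: "real \<times> real \<Rightarrow> state"
  assumes ranges: "\<alpha>0 > 0" "\<beta>L < \<beta>s"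
    and smooth: "\<exists>U. open U \<and> {- \<alpha>0..0} \<times> {\<beta>L..\<beta>s} \<subseteq> U \<and> C2_on X U \<and> C2_on Y U \<and> C2_on F U"
    and admissible: "\<And>z. z \<in> {- \<alpha>0..0} \<times> {\<beta>L..\<beta>s} \<Longrightarrow> admissible (F z)"
    and characteristic_minus:
      "\<And>z. z \<in> {- \<alpha>0..0} \<times> {\<beta>L..\<beta>s} \<Longrightarrow> pd1 X z = (u1 (F z) - sound (F z)) * pd1 Y z"
    and characteristic_plus:
      "\<And>z. z \<in> {- \<alpha>0..0} \<times> {\<beta>L..\<beta>s} \<Longrightarrow> pd2 X z = (u1 (F z) + sound (F z)) * pd2 Y z"
    and nondegenerate: "\<And>z. z \<in> {- \<alpha>0..0} \<times> {\<beta>L..\<beta>s} \<Longrightarrow> pd1 Y z \<noteq> 0"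
    and origin: "\<And>\<beta>. \<beta> \<in> {\<beta>L..\<beta>s} \<Longrightarrow> X (0, \<beta>) = 0 \<and> Y (0, \<beta>) = 0"
    and slope: "\<And>\<beta>. \<beta> \<in> {\<beta>L..\<beta>s} \<Longrightarrow> pd1 X (0, \<beta>) = \<beta> * pd1 Y (0, \<beta>)"
    and positive_time:
      "\<And>z. z \<in> {- \<alpha>0..<0} \<times> {\<beta>L..\<beta>s} \<Longrightarrow> 0 < Y z \<and> Y z < T"
    and head: "\<And>\<alpha>. \<alpha> \<in> {- \<alpha>0..<0} \<Longrightarrow> X (\<alpha>, \<beta>L) = \<eta> (Y (\<alpha>, \<beta>L))"
    and tail: "\<And>\<alpha>. \<alpha> \<in> {- \<alpha>0..<0} \<Longrightarrow> X (\<alpha>, \<beta>s) = \<gamma>0 (Y (\<alpha>, \<beta>s))"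
    and interior:
      "\<And>z. z \<in> {- \<alpha>0..<0} \<times> {\<beta>L<..<\<beta>s} \<Longrightarrow> (X z, Y z) \<in> wave_region T \<eta> \<gamma>0"
    and injective: "inj_on (\<lambda>z. (X z, Y z)) ({- \<alpha>0..<0} \<times> {\<beta>L..\<beta>s})"
    and covering:
      "\<exists>\<delta>>0. \<forall>x t. 0 < t \<and> t < \<delta> \<and> \<eta> t \<le> x \<and> x \<le> \<gamma>0 t \<longrightarrow>
         (x, t) \<in> (\<lambda>z. (X z, Y z)) ` ({- \<alpha>0..<0} \<times> {\<beta>L..\<beta>s})"
    and represents:
      "\<And>z. z \<in> {- \<alpha>0..<0} \<times> {\<beta>L..\<beta>s} \<Longrightarrow> F z = V (X z, Y z)"
    and continuous_across_head_and_tail: "continuous_on (wave_region T (\<lambda>_. - r) \<gamma>1) V"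
    and invariants_at_origin:
      "\<And>w \<beta>. w \<in> {psi1, S1, psi2, psi3, S2} \<Longrightarrow> \<beta> \<in> {\<beta>L..\<beta>s} \<Longrightarrow> w (F (0, \<beta>)) = w VL"
    and invariants_x_derivative:
      "\<And>w. w \<in> {psi1, S1, psi2, psi3, S2} \<Longrightarrow>
         \<exists>g. continuous_on ({- \<alpha>0..0} \<times> {\<beta>L..\<beta>s}) g \<and>
             (\<forall>z \<in> {- \<alpha>0..<0} \<times> {\<beta>L<..<\<beta>s}. g z = pd1 (\<lambda>y. w (V y)) (X z, Y z))"
    and invariants_t_derivative:
      "\<And>w. w \<in> {psi1, S1, psi2, psi3, S2} \<Longrightarrow>
         \<exists>g. continuous_on ({- \<alpha>0..0} \<times> {\<beta>L..\<beta>s}) g \<and>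
             (\<forall>z \<in> {- \<alpha>0..<0} \<times> {\<beta>L<..<\<beta>s}. g z = pd2 (\<lambda>y. w (V y)) (X z, Y z))"
    and invariants_C1_across_tail:
      "\<And>w. w \<in> {psi1, S1, psi2, psi3, S2} \<Longrightarrow> C1_on (\<lambda>y. w (V y)) (wave_region T \<eta> \<gamma>1)"


section \<open>Left data\<close>

text \<open>In each of the following \<open>v\<close> is a state and \<open>d\<close> its spatial derivative.\<close>

definition S1_prime :: "state \<Rightarrow> state \<Rightarrow> real" where
  "S1_prime v d = 1 / rho v ^ 3 * (p11 d - (sound v)\<^sup>2 * rho d)"

definition psi2_prime :: "state \<Rightarrow> state \<Rightarrow> real" where
  "psi2_prime v d =
     u2 d + sqrt 3 / sqrt (rho v * p11 v) * p12 d
       - sqrt 3 * p12 v / (2 * rho v * sqrt (rho v * p11 v)) * rho d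
       - sqrt 3 * p12 v / (2 * p11 v * sqrt (rho v * p11 v)) * p11 d"

definition psi3_prime :: "state \<Rightarrow> state \<Rightarrow> real" where
  "psi3_prime v d = p12 d / rho v ^ 3 - 3 * p12 v / rho v ^ 4 * rho d"

definition S2_prime :: "state \<Rightarrow> state \<Rightarrow> real" where
  "S2_prime v d =
     p11 v / rho v ^ 4 * p22 d + p22 v / rho v ^ 4 * p11 d
       - 2 * p12 v / rho v ^ 4 * p12 d - 4 * detp v / rho v ^ 5 * rho d"

definition Pi2 :: "state \<Rightarrow> state \<Rightarrow> real" where
  "Pi2 v d =
     2 / rho v * p12 d - 3 * p12 v / (2 * (rho v)\<^sup>2) * rho d
       - 3 * p12 v / (2 * rho v * p11 v) * p11 d"

definition Pi3 :: "state \<Rightarrow> state \<Rightarrow> real" where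
  "Pi3 v d =
     sound v / rho v ^ 3 * p12 d + p12 v / rho v ^ 3 * u1 d
       - p11 v / rho v ^ 3 * u2 d - 3 * p12 v * sound v / rho v ^ 4 * rho d"

definition kappa2 :: "state \<Rightarrow> state \<Rightarrow> real" where
  "kappa2 v d = 1 / (2 * sound v) * (Pi2 v d - 2 * sound v * psi2_prime v d)"

definition kappa3 :: "state \<Rightarrow> state \<Rightarrow> real" where
  "kappa3 v d = 1 / (2 * sound v) * (Pi3 v d - 2 * sound v * psi3_prime v d)"


section \<open>Coefficients\<close>

text \<open>Arguments: \<open>vl\<close>, \<open>dl\<close> the left state and slope, \<open>vs\<close> the limiting state of region \<open>*L\<close>,
  \<open>wx\<close> the value \<open>W' 0\<close>, \<open>Du1\<close>, \<open>Dp11\<close> the limiting material derivatives and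
  \<open>rho_t\<close>, \<open>p11_t\<close> the limiting time derivatives in \<open>*L\<close>.\<close>

definition qL :: "state \<Rightarrow> state \<Rightarrow> real" where
  "qL vl vs = (lam1 vs - lam1 vl) / 4 * psi1 vl - lam1 vs"

definition a3 :: "state \<Rightarrow> state \<Rightarrow> real" where
  "a3 vl vs = 1 + sqrt 3 * rho vs * u1 vs / sqrt (rho vs * p11 vs) + qL vl vs / sound vs"

definition b3 :: "state \<Rightarrow> real" where
  "b3 vs = u1 vs / p11 vs + sqrt 3 / sqrt (rho vs * p11 vs)"

definition d3 :: "state \<Rightarrow> state \<Rightarrow> state \<Rightarrow> real \<Rightarrow> real \<Rightarrow> real \<Rightarrow> real \<Rightarrow> real \<Rightarrow> real" where
  "d3 vl dl vs wx Du1 Dp11 rho_t p11_t =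
     (kappa2 vl dl + Pi2 vl dl / (8 * sound vl) * (lam1 vs - lam1 vl)) * psi1 vl
     + qL vl vs / (2 * sound vs) *
         (2 * p12 vs / p11 vs * (Du1 + 1 / 2 * wx)
          + S1_prime vl dl / sound vl * (sound vs * (rho vs)\<^sup>2 * p12 vs / (2 * p11 vs)))
     + sqrt 3 * p12 vs / (2 * rho vs * sqrt (rho vs * p11 vs)) * rho_t
     + sqrt 3 * p12 vs / (2 * p11 vs * sqrt (rho vs * p11 vs)) * p11_t
     + 2 * u1 vs * p12 vs / (3 * (p11 vs)\<^sup>2) * Dp11"

definition a4 :: "state \<Rightarrow> state \<Rightarrow> real" where
  "a4 vl vs = 1 / (rho vs)\<^sup>2 * (u1 vs + qL vl vs / 2)"

definition b4 :: "state \<Rightarrow> state \<Rightarrow> real" where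
  "b4 vl vs = 1 / rho vs ^ 3 * (1 - qL vl vs / (2 * sound vs))"

definition d4 :: "state \<Rightarrow> state \<Rightarrow> state \<Rightarrow> real \<Rightarrow> real \<Rightarrow> real \<Rightarrow> real \<Rightarrow> real" where
  "d4 vl dl vs wx Du1 Dp11 rho_t =
     (kappa3 vl dl + Pi3 vl dl / (8 * sound vl) * (lam1 vs - lam1 vl)) * psi1 vl
     + 3 * p12 vs / rho vs ^ 4 * rho_t
     + qL vl vs / (2 * sound vs) *
         (1 / rho vs ^ 3 *
            (- (p12 vs / p11 vs) * Dp11 + 3 * p12 vs / sound vs * (Du1 + 1 / 2 * wx))
          + S1_prime vl dl / sound vl * (3 * p12 vs / rho vs))"

end

theory Submission
  imports Defs
begin

text \<open>
In the region \<open>*L\<close> the solution and its first derivatives have limits at the origin, and the limits again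
satisfy the ten-moment equations, now as algebraic relations between a state \<open>v\<close>, its \<open>x\<close>-derivative and
its \<open>t\<close>-derivative (\<open>limit_jet\<close>). Given the material derivatives of \<open>u1\<close> and \<open>p11\<close>, these relations express
the derivatives of \<open>u1\<close>, \<open>u2\<close>, \<open>p11\<close> and \<open>p12\<close> through the two unknown material derivatives of \<open>u2\<close> and
\<open>p12\<close>. Substituting this into the two quadrature relations produces two linear equations with the coefficients
\<open>a3, b3, d3\<close> and \<open>a4, b4, d4\<close>, which Cramer's rule solves
(\<open>psi2_quadrature_coefficients\<close>, \<open>psi3_quadrature_coefficients\<close>).

This needs the derivative of \<open>\<rho>\<close> in \<open>*L\<close>, and the formula for \<open>p22\<close> needs that of \<open>p22\<close>. Both come from the
left data through the entropies \<open>S1\<close> and \<open>S2\<close>, which are transported along particle paths: for both,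
\<open>S\<^sub>x / c\<close> at the origin has the same value on the two sides of the rarefaction fan
(\<open>entropy_derivative_across_fan\<close>).

Here is why. In characteristic coordinates the origin is blown up to the segment \<open>\<alpha> = 0\<close>. On it, \<open>t\<close> and the
entropy \<open>\<Sigma>\<close> are constant, so the information lies in the \<open>\<alpha>\<close>-derivatives. Transport amounts to
\<open>\<Sigma>\<^sub>\<alpha> t\<^sub>\<beta> + \<Sigma>\<^sub>\<beta> t\<^sub>\<alpha> = 0\<close>, and differentiating this at \<open>\<alpha> = 0\<close> shows that \<open>\<Sigma>\<^sub>\<alpha> t\<^sub>\<alpha>\<close> is constant in \<open>\<beta>\<close>
(\<open>entropy_times_time_scale\<close>). In the same way \<open>x\<^sub>\<beta> = (u1 + c) t\<^sub>\<beta>\<close> shows that \<open>c t\<^sub>\<alpha>\<close> is constant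
(\<open>sound_times_time_scale\<close>). As \<open>\<Sigma>\<^sub>\<alpha> = - c t\<^sub>\<alpha> S\<^sub>x\<close>, the quotient \<open>S\<^sub>x / c\<close> is constant too.

At the two ends of the segment, \<open>\<Sigma>\<^sub>\<alpha>\<close> must be compared with the limits from the neighbouring regions, although the state
\<open>V\<close> is only known to be continuous across the head and the tail. The derivative along such an edge is nevertheless determined
by the limit gradient of either side (\<open>one_sided_derivative_on_boundary_curve\<close>), and because
\<open>u1 - c\<close> differs from \<open>u1\<close>, the transport equation turns this tangential derivative into \<open>S\<^sub>x\<close>.
\<close>

section \<open>Partial derivatives in the plane\<close>

lemma pd_of_derivative:
  assumes "(f has_derivative D) (at z)"
  shows "pd1 f z = D (1, 0)" "pd2 f z = D (0, 1)"
proof -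
  obtain a b where z: "z = (a, b)" by (cases z)
  have D: "linear D" using assms has_derivative_linear by blast
  have "((\<lambda>s. f (s, b)) has_derivative (\<lambda>h. D (h, 0))) (at a)"
    using has_derivative_compose[OF has_derivative_Pair[OF has_derivative_ident has_derivative_const], of f D a b UNIV]
      assms z by simp
  moreover have "(\<lambda>h. D (h, 0)) = (\<lambda>h. h *\<^sub>R D (1, 0))"
    by (rule ext) (simp flip: linear_scale[OF D])
  ultimately show "pd1 f z = D (1, 0)"
    unfolding pd1_def z fst_conv snd_conv
    by (intro vector_derivative_at) (simp only: has_vector_derivative_def)
  have "((\<lambda>s. f (a, s)) has_derivative (\<lambda>h. D (0, h))) (at b)"
    using has_derivative_compose[OF has_derivative_Pair[OF has_derivative_const has_derivative_ident], of f D a b UNIV]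
      assms z by simp
  moreover have "(\<lambda>h. D (0, h)) = (\<lambda>h. h *\<^sub>R D (0, 1))"
    by (rule ext) (simp flip: linear_scale[OF D])
  ultimately show "pd2 f z = D (0, 1)"
    unfolding pd2_def z fst_conv snd_conv
    by (intro vector_derivative_at) (simp only: has_vector_derivative_def)
qed

lemma has_derivative_pd:
  assumes "f differentiable (at z)"
  shows "(f has_derivative (\<lambda>h. fst h *\<^sub>R pd1 f z + snd h *\<^sub>R pd2 f z)) (at z)"
proof -
  obtain D where D: "(f has_derivative D) (at z)"
    using assms differentiable_def by blast
  have lin: "linear D" using D has_derivative_linear by blast
  have "D h = fst h *\<^sub>R D (1, 0) + snd h *\<^sub>R D (0, 1)" for h
  proof -
    have "D (fst h *\<^sub>R (1, 0) + snd h *\<^sub>R (0, 1)) = fst h *\<^sub>R D (1, 0) + snd h *\<^sub>R D (0, 1)"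
      by (simp only: linear_add[OF lin] linear_scale[OF lin])
    then show ?thesis by simp
  qed
  then have "D = (\<lambda>h. fst h *\<^sub>R pd1 f z + snd h *\<^sub>R pd2 f z)"
    unfolding pd_of_derivative[OF D] by (rule ext)
  with D show ?thesis by (simp only:)
qed

lemma pd_has_vector_derivative:
  assumes "f differentiable (at (a, b))"
  shows "((\<lambda>s. f (s, b)) has_vector_derivative pd1 f (a, b)) (at a)"
    and "((\<lambda>s. f (a, s)) has_vector_derivative pd2 f (a, b)) (at b)"
proof -
  note D = has_derivative_pd[OF assms]
  show "((\<lambda>s. f (s, b)) has_vector_derivative pd1 f (a, b)) (at a)"
    unfolding has_vector_derivative_def
    using has_derivative_compose[OF has_derivative_Pair[OF has_derivative_ident has_derivative_const] D] by simp
  show "((\<lambda>s. f (a, s)) has_vector_derivative pd2 f (a, b)) (at b)"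
    unfolding has_vector_derivative_def
    using has_derivative_compose[OF has_derivative_Pair[OF has_derivative_const has_derivative_ident] D] by simp
qed

lemma pd_has_real_derivative:
  fixes f :: "real \<times> real \<Rightarrow> real"
  assumes "f differentiable (at (a, b))"
  shows "((\<lambda>s. f (s, b)) has_real_derivative pd1 f (a, b)) (at a)"
    and "((\<lambda>s. f (a, s)) has_real_derivative pd2 f (a, b)) (at b)"
  using pd_has_vector_derivative[OF assms]
  by (simp_all add: has_real_derivative_iff_has_vector_derivative)

lemma pd_compose:
  assumes "V differentiable (at z)" and "(S has_derivative S') (at (V z))"
  shows "pd1 (\<lambda>y. S (V y)) z = S' (pd1 V z)" "pd2 (\<lambda>y. S (V y)) z = S' (pd2 V z)"
  using pd_of_derivative[OF has_derivative_compose[OF has_derivative_pd[OF assms(1)] assms(2)]]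
  by auto

lemma pd_along_curve:
  assumes "V differentiable (at (p s))"
    and "(p has_vector_derivative p') (at s)"
  shows "((\<lambda>s. V (p s)) has_vector_derivative fst p' *\<^sub>R pd1 V (p s) + snd p' *\<^sub>R pd2 V (p s)) (at s)"
  using has_derivative_compose[OF assms(2)[unfolded has_vector_derivative_def] has_derivative_pd[OF assms(1)]]
  by (simp add: has_vector_derivative_def algebra_simps)

text \<open>By the mean value theorem in the first variable, the double increment over a square of side \<open>h\<close>
is \<open>h\<close> times an increment of \<open>pd1 f\<close> along a vertical segment of length \<open>h\<close>; differentiability
of \<open>pd1 f\<close> at the corner turns this into \<open>h\<^sup>2\<close> times \<open>pd2 (pd1 f)\<close>, up to \<open>o(h\<^sup>2)\<close>.\<close>

lemma mixed_pd_quotient: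
  fixes f :: "real \<times> real \<Rightarrow> real"
  assumes U: "open U" "(a, b) \<in> U" "\<And>w. w \<in> U \<Longrightarrow> f differentiable (at w)"
    and d: "pd1 f differentiable (at (a, b))"
  shows "((\<lambda>h. (f (a + h, b + h) - f (a + h, b) - f (a, b + h) + f (a, b)) / h\<^sup>2)
            \<longlongrightarrow> pd2 (pd1 f) (a, b)) (at_right 0)"
proof (rule tendstoI)
  fix \<epsilon> :: real assume \<epsilon>: "\<epsilon> > 0"
  define P where "P = pd1 (pd1 f) (a, b)"
  define Q where "Q = pd2 (pd1 f) (a, b)"
  note D = has_derivative_pd[OF d, folded P_def Q_def]
  obtain d1 where d1: "d1 > 0" "\<And>y. norm (y - (a, b)) < d1 \<Longrightarrow>
      norm (pd1 f y - pd1 f (a, b) - (fst (y - (a, b)) *\<^sub>R P + snd (y - (a, b)) *\<^sub>R Q))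
        \<le> \<epsilon> / 8 * norm (y - (a, b))"
    using D[unfolded has_derivative_at_alt, THEN conjunct2, rule_format, of "\<epsilon> / 8"] \<epsilon> by auto
  obtain d2 where d2: "d2 > 0" "ball (a, b) d2 \<subseteq> U"
    using U openE by blast
  define \<delta> where "\<delta> = min d1 d2 / 2"
  have \<delta>: "\<delta> > 0" using d1 d2 by (simp add: \<delta>_def)
  have *: "dist ((f (a + h, b + h) - f (a + h, b) - f (a, b + h) + f (a, b)) / h\<^sup>2) Q < \<epsilon>"
    if h: "0 < h" "h < \<delta>" for h
  proof -
    have near: "norm ((s, t) - (a, b)) \<le> 2 * h \<and> norm ((s, t) - (a, b)) < d1 \<and> (s, t) \<in> U"
      if "a \<le> s" "s \<le> a + h" "b \<le> t" "t \<le> b + h" for s t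
    proof -
      have "norm ((s, t) - (a, b)) \<le> norm (s - a) + norm (t - b)"
        using norm_Pair_le[of "s - a" "t - b"] by simp
      then have n: "norm ((s, t) - (a, b)) \<le> 2 * h" using that by simp
      then have "norm ((s, t) - (a, b)) < d1" "norm ((s, t) - (a, b)) < d2"
        using h by (auto simp: \<delta>_def)
      moreover from this(2) have "(s, t) \<in> ball (a, b) d2"
        unfolding mem_ball by (subst dist_commute) (simp only: dist_norm)
      ultimately show ?thesis using n d2(2) by blast
    qed
    have near1: "\<bar>pd1 f (s, t) - pd1 f (a, b) - ((s - a) * P + (t - b) * Q)\<bar> \<le> \<epsilon> / 8 * (2 * h)"
      if "a \<le> s" "s \<le> a + h" "b \<le> t" "t \<le> b + h" for s t
    proof -
      have "\<bar>pd1 f (s, t) - pd1 f (a, b) - ((s - a) * P + (t - b) * Q)\<bar> \<le> \<epsilon> / 8 * norm ((s, t) - (a, b))"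
        using d1(2)[of "(s, t)"] near[OF that] by simp
      also have "\<dots> \<le> \<epsilon> / 8 * (2 * h)"
        using near[OF that] \<epsilon> by (intro mult_left_mono) auto
      finally show ?thesis .
    qed
    define g where "g s = f (s, b + h) - f (s, b)" for s
    have "\<exists>x\<in>{a<..<a+h}. g (a + h) - g a = (\<lambda>k. k * (pd1 f (x, b + h) - pd1 f (x, b))) (a + h - a)"
    proof (rule mvt_simple)
      fix x assume x: "a \<le> x" "x \<le> a + h"
      have "f differentiable (at (x, b + h))" "f differentiable (at (x, b))"
        using near[of x "b + h"] near[of x b] U(3) x h by auto
      from pd_has_vector_derivative(1)[OF this(1)] pd_has_vector_derivative(1)[OF this(2)]
      have "(g has_vector_derivative pd1 f (x, b + h) - pd1 f (x, b)) (at x)"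
        unfolding g_def by (intro derivative_intros)
      then show "(g has_derivative (\<lambda>k. k * (pd1 f (x, b + h) - pd1 f (x, b)))) (at x within {a..a + h})"
        by (simp add: has_vector_derivative_def has_derivative_at_withinI)
    qed (use h in auto)
    then obtain x where x: "a < x" "x < a + h"
      and gx: "g (a + h) - g a = h * (pd1 f (x, b + h) - pd1 f (x, b))"
      by auto
    have e1: "\<bar>pd1 f (x, b + h) - pd1 f (a, b) - ((x - a) * P + h * Q)\<bar> \<le> \<epsilon> / 8 * (2 * h)"
      using near1[of x "b + h"] x h by simp
    have e2: "\<bar>pd1 f (x, b) - pd1 f (a, b) - (x - a) * P\<bar> \<le> \<epsilon> / 8 * (2 * h)"
      using near1[of x b] x h by simp
    have "\<bar>pd1 f (x, b + h) - pd1 f (x, b) - h * Q\<bar> \<le> \<epsilon> / 2 * h"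
      using e1 e2 by argo
    also have "\<dots> < \<epsilon> * h" using \<epsilon> h by simp
    finally have lt: "\<bar>(pd1 f (x, b + h) - pd1 f (x, b)) - h * Q\<bar> < \<epsilon> * h" .
    have "(f (a + h, b + h) - f (a + h, b) - f (a, b + h) + f (a, b)) / h\<^sup>2 - Q
          = ((pd1 f (x, b + h) - pd1 f (x, b)) - h * Q) / h"
    proof -
      have "f (a + h, b + h) - f (a + h, b) - f (a, b + h) + f (a, b) = h * (pd1 f (x, b + h) - pd1 f (x, b))"
        using gx by (simp add: g_def)
      then show ?thesis
        using h by (simp only: power2_eq_square) (simp add: diff_divide_distrib)
    qed
    moreover have "\<bar>((pd1 f (x, b + h) - pd1 f (x, b)) - h * Q) / h\<bar> < \<epsilon>"
      using lt h by (simp only: abs_divide) (simp add: pos_divide_less_eq)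
    ultimately show ?thesis
      by (simp only: dist_real_def)
  qed
  show "\<forall>\<^sub>F h in at_right 0. dist ((f (a + h, b + h) - f (a + h, b) - f (a, b + h) + f (a, b)) / h\<^sup>2)
          (pd2 (pd1 f) (a, b)) < \<epsilon>"
    unfolding eventually_at_right_field Q_def[symmetric]
    using \<delta> * by (intro exI[of _ \<delta>]) auto
qed

text \<open>Young's form of the symmetry of second derivatives: the double increment is symmetric in the two
variables, so its quotient by \<open>h\<^sup>2\<close> has both mixed derivatives as its limit. Unlike in the version for
\<open>C\<^sup>2\<close> functions, the first derivatives need only be differentiable at the point itself, which is
convenient for a composition with an entropy.\<close>

lemma mixed_pd_symmetric:
  fixes f :: "real \<times> real \<Rightarrow> real"
  assumes U: "open U" "z \<in> U" "\<And>w. w \<in> U \<Longrightarrow> f differentiable (at w)"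
    and d1: "pd1 f differentiable (at z)" and d2: "pd2 f differentiable (at z)"
  shows "pd1 (pd2 f) z = pd2 (pd1 f) z"
proof -
  obtain a b where z: "z = (a, b)" by (cases z)
  let ?g = "f \<circ> prod.swap"
  have sw: "(prod.swap has_derivative prod.swap) (at w)" for w :: "real \<times> real"
    unfolding prod.swap_def[abs_def]
    by (intro bounded_linear_imp_has_derivative bounded_linear_Pair bounded_linear_fst bounded_linear_snd)
  have pd: "pd1 ?g = pd2 f \<circ> prod.swap" "pd2 (pd2 f \<circ> prod.swap) = pd1 (pd2 f) \<circ> prod.swap"
    by (auto simp: pd1_def pd2_def fun_eq_iff)
  have cmp: "(k \<circ> prod.swap) differentiable (at w)" if "k differentiable (at (prod.swap w))"
    for k :: "real \<times> real \<Rightarrow> real" and w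
    using differentiable_chain_at[of prod.swap w k] sw[of w] that unfolding differentiable_def by blast
  have "open (prod.swap -` U)"
    by (intro open_vimage U) (auto simp: prod.swap_def[abs_def] intro!: continuous_intros)
  then have "((\<lambda>h. (?g (b + h, a + h) - ?g (b + h, a) - ?g (b, a + h) + ?g (b, a)) / h\<^sup>2)
            \<longlongrightarrow> pd2 (pd1 ?g) (b, a)) (at_right 0)"
    using U d2 z by (intro mixed_pd_quotient[where U = "prod.swap -` U"])
      (simp_all only: pd, auto intro!: cmp simp del: o_apply)
  then have "((\<lambda>h. (f (a + h, b + h) - f (a + h, b) - f (a, b + h) + f (a, b)) / h\<^sup>2)
            \<longlongrightarrow> pd1 (pd2 f) (a, b)) (at_right 0)"
    by (simp add: pd algebra_simps)
  moreover have "((\<lambda>h. (f (a + h, b + h) - f (a + h, b) - f (a, b + h) + f (a, b)) / h\<^sup>2)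
            \<longlongrightarrow> pd2 (pd1 f) (a, b)) (at_right 0)"
    using U d1 z by (intro mixed_pd_quotient[where U = U]) auto
  ultimately show ?thesis
    using z tendsto_unique trivial_limit_at_right_real by blast
qed

text \<open>The vertex of a fan is the edge \<open>\<alpha> = 0\<close> of the parameter rectangle, and identities between smooth
functions are known only on the side \<open>\<alpha> \<le> 0\<close>; this suffices to differentiate them at \<open>\<alpha> = 0\<close>.\<close>

lemma derivative_zero_if_zero_left:
  fixes h :: "real \<Rightarrow> real"
  assumes h: "(h has_real_derivative d) (at 0)" and a: "a > 0"
    and z: "\<And>s. - a < s \<Longrightarrow> s \<le> 0 \<Longrightarrow> h s = 0"
  shows "d = 0"
proof -
  have "((\<lambda>y. (h y - h 0) / (y - 0)) \<longlongrightarrow> d) (at_left 0)"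
    using h unfolding has_field_derivative_iff by (rule filterlim_mono) (auto simp: at_le)
  moreover have "\<forall>\<^sub>F y in at_left 0. (h y - h 0) / (y - 0) = 0"
    unfolding eventually_at_left_field using a z by (intro exI[of _ "- a"]) auto
  ultimately have "((\<lambda>y. 0) \<longlongrightarrow> d) (at_left (0::real))"
    by (rule Lim_transform_eventually)
  then show ?thesis
    using tendsto_unique[OF _ _ tendsto_const] trivial_limit_at_left_real by (metis)
qed

lemma vector_derivative_quotient:
  assumes "(f has_vector_derivative d) (at 0)"
  shows "((\<lambda>s. (1 / s) *\<^sub>R (f s - f 0)) \<longlongrightarrow> d) (at 0)"
proof -
  have "((\<lambda>s. (1 / norm s) *\<^sub>R (f s - (f 0 + s *\<^sub>R d))) \<longlongrightarrow> 0) (at 0)"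
    using assms[unfolded has_vector_derivative_def has_derivative_at2] by simp
  moreover have "\<forall>\<^sub>F s in at 0. norm ((1 / norm s) *\<^sub>R (f s - (f 0 + s *\<^sub>R d)))
      = norm ((1 / s) *\<^sub>R (f s - f 0) - d)"
  proof (rule eventually_at_filter[THEN iffD2], rule always_eventually, intro allI impI)
    fix s :: real assume s: "s \<noteq> 0"
    have "(1 / s) *\<^sub>R (f s - f 0) - d = (1 / s) *\<^sub>R (f s - (f 0 + s *\<^sub>R d))"
      using s by (simp add: algebra_simps)
    then show "norm ((1 / norm s) *\<^sub>R (f s - (f 0 + s *\<^sub>R d))) = norm ((1 / s) *\<^sub>R (f s - f 0) - d)"
      by (simp only: norm_scaleR) simp
  qed
  ultimately have "((\<lambda>s. norm ((1 / s) *\<^sub>R (f s - f 0) - d)) \<longlongrightarrow> 0) (at 0)"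
    by (rule Lim_transform_eventually[OF tendsto_norm_zero])
  then show ?thesis
    by (rule LIM_zero_cancel[OF tendsto_norm_zero_cancel])
qed

text \<open>Let \<open>V\<close> and its first derivatives have limits \<open>A\<close>, \<open>B\<close>, \<open>C\<close> at the origin from a region \<open>R\<close>, and let
\<open>G\<close> be the trace of \<open>V\<close> on a curve \<open>p\<close> in the boundary of \<open>R\<close> that ends at the origin. Then \<open>G\<close> tends to
\<open>A\<close> and has a one-sided derivative there, given by the chain rule with the limit gradient. The region has no regularity
beyond what \<open>push\<close> says: compact pieces of the curve move into \<open>R\<close> when shifted a little in the
direction \<open>e\<close>. The mean value inequality for \<open>V - x B - t C\<close>, whose gradient is small near the origin,
is applied on the shifted curve; the shift then tends to \<open>0\<close>, and after that the upper end
of the piece tends to the origin.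

Three boundary curves are treated in this way: the initial line, and the head and the tail of the fan.\<close>

lemma one_sided_derivative_on_boundary_curve:
  fixes V :: "real \<times> real \<Rightarrow> 'a::real_normed_vector"
    and p p' :: "real \<Rightarrow> real \<times> real"
  assumes diff: "\<And>z. z \<in> R \<Longrightarrow> V differentiable (at z)" and R0: "0 \<notin> R"
    and A: "(V \<longlongrightarrow> A) (at 0 within R)"
    and B: "(pd1 V \<longlongrightarrow> B) (at 0 within R)" and C: "(pd2 V \<longlongrightarrow> C) (at 0 within R)"
    and a: "a > 0" and p0: "p 0 = 0"
    and q: "(p has_vector_derivative q) (at 0)"
    and p': "\<And>s. - a < s \<Longrightarrow> s < 0 \<Longrightarrow> (p has_vector_derivative p' s) (at s)"
    and p'q: "(p' \<longlongrightarrow> q) (at_left 0)"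
    and push: "\<And>s1 s2. - a < s1 \<Longrightarrow> s1 \<le> s2 \<Longrightarrow> s2 < 0 \<Longrightarrow>
      \<exists>h0>0. \<forall>s h. s1 \<le> s \<and> s \<le> s2 \<and> 0 < h \<and> h < h0 \<longrightarrow> p s + h *\<^sub>R e \<in> R"
    and G: "\<And>s. - a < s \<Longrightarrow> s < 0 \<Longrightarrow> ((\<lambda>h. V (p s + h *\<^sub>R e)) \<longlongrightarrow> G s) (at_right 0)"
  shows "(G \<longlongrightarrow> A) (at_left 0)"
    and "((\<lambda>s. (1 / s) *\<^sub>R (G s - A)) \<longlongrightarrow> fst q *\<^sub>R B + snd q *\<^sub>R C) (at_left 0)"
proof -
  have pc: "(p \<longlongrightarrow> 0) (at_left 0)"
    using has_vector_derivative_continuous[OF q] p0 unfolding continuous_at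
    by (metis filterlim_at_split)
  have ev_in: "\<forall>\<^sub>F h in at_right 0. p s + h *\<^sub>R e \<in> R" if "- a < s" "s < 0" for s
    using push[of s s] that unfolding eventually_at_right_field by force
  have ev_near: "\<forall>\<^sub>F h in at_right 0. norm (p s + h *\<^sub>R e) < d" if "norm (p s) < d" for s d
  proof -
    have "((\<lambda>h. norm (p s + h *\<^sub>R e)) \<longlongrightarrow> norm (p s + 0 *\<^sub>R e)) (at_right 0)"
      by (intro tendsto_intros)
    then show ?thesis using that by (intro order_tendstoD(2)) auto
  qed
  show GA: "(G \<longlongrightarrow> A) (at_left 0)"
  proof (rule tendstoI)
    fix \<epsilon> :: real assume "\<epsilon> > 0"
    then obtain d where d: "d > 0" "\<And>z. z \<in> R \<Longrightarrow> norm z < d \<Longrightarrow> dist (V z) A < \<epsilon> / 2"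
      using tendstoD[OF A, of "\<epsilon> / 2"] R0 unfolding eventually_at dist_norm diff_0_right
      by (metis half_gt_zero)
    have "\<forall>\<^sub>F s in at_left 0. norm (p s) < d"
      using tendstoD[OF pc d(1)] by (simp add: dist_norm)
    moreover have "\<forall>\<^sub>F s in at_left (0::real). - a < s \<and> s < 0"
      unfolding eventually_at_left_field using a by (intro exI[of _ "- a"]) auto
    ultimately show "\<forall>\<^sub>F s in at_left 0. dist (G s) A < \<epsilon>"
    proof eventually_elim
      case (elim s)
      have "\<forall>\<^sub>F h in at_right 0. dist (V (p s + h *\<^sub>R e)) A \<le> \<epsilon> / 2"
        using ev_in[OF elim(2)[THEN conjunct1] elim(2)[THEN conjunct2]] ev_near[OF elim(1)]
        by eventually_elim (blast intro: d(2) less_imp_le)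
      then have "dist (G s) A \<le> \<epsilon> / 2"
        by (intro tendsto_upperbound[OF tendsto_dist[OF G tendsto_const]])
           (use elim in auto)
      then show ?case using \<open>\<epsilon> > 0\<close> by simp
    qed
  qed
  define K where "K = norm q + 1"
  have K: "K > 0" by (simp add: K_def add_nonneg_pos)
  \<comment> \<open>\<open>E\<close> is the trace of \<open>V - x B - t C\<close>; it remains to see that it is \<open>A + o(s)\<close>.\<close>
  define E where "E s = G s - fst (p s) *\<^sub>R B - snd (p s) *\<^sub>R C" for s
  have EA: "(E \<longlongrightarrow> A) (at_left 0)"
    using tendsto_diff[OF tendsto_diff[OF GA tendsto_scaleR[OF tendsto_fst[OF pc] tendsto_const[of B]]]
        tendsto_scaleR[OF tendsto_snd[OF pc] tendsto_const[of C]]]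
    by (simp add: E_def[abs_def])
  have "((\<lambda>s. (1 / s) *\<^sub>R (E s - A)) \<longlongrightarrow> 0) (at_left 0)"
  proof (rule tendstoI)
    fix \<epsilon>' :: real assume "\<epsilon>' > 0"
    define \<epsilon> where "\<epsilon> = \<epsilon>' / (4 * K)"
    have \<epsilon>: "\<epsilon> > 0" using \<open>\<epsilon>' > 0\<close> K by (simp add: \<epsilon>_def)
    obtain d1 where d1: "d1 > 0" "\<And>z. z \<in> R \<Longrightarrow> norm z < d1 \<Longrightarrow> norm (pd1 V z - B) < \<epsilon>"
      using tendstoD[OF B \<epsilon>] R0 unfolding eventually_at dist_norm diff_0_right by metis
    obtain d2 where d2: "d2 > 0" "\<And>z. z \<in> R \<Longrightarrow> norm z < d2 \<Longrightarrow> norm (pd2 V z - C) < \<epsilon>"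
      using tendstoD[OF C \<epsilon>] R0 unfolding eventually_at dist_norm diff_0_right by metis
    define d where "d = min d1 d2"
    have d: "d > 0" using d1 d2 by (simp add: d_def)
    have "\<forall>\<^sub>F s in at_left 0. norm (p s) < d / 2"
      using tendstoD[OF pc, of "d / 2"] d by (simp add: dist_norm)
    moreover have "\<forall>\<^sub>F s in at_left 0. norm (p' s) < K"
      using order_tendstoD(2)[OF tendsto_norm[OF p'q], of K] by (simp add: K_def)
    ultimately have "\<forall>\<^sub>F s in at_left 0. norm (p s) < d / 2 \<and> norm (p' s) < K"
      by (rule eventually_conj)
    then obtain c0 where c0: "c0 < 0" "\<And>s. c0 < s \<Longrightarrow> s < 0 \<Longrightarrow> norm (p s) < d / 2 \<and> norm (p' s) < K"
      unfolding eventually_at_left_field by auto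
    define c where "c = max c0 (- a)"
    have c: "c < 0" "\<And>s. c < s \<Longrightarrow> s < 0 \<Longrightarrow> norm (p s) < d / 2 \<and> norm (p' s) < K \<and> - a < s"
      using c0 a by (auto simp: c_def)
    \<comment> \<open>The factor 2 accounts for the two components of the gradient.\<close>
    have step: "norm (E s2 - E s1) \<le> 2 * K * \<epsilon> * (s2 - s1)" if s: "c < s1" "s1 < s2" "s2 < 0" for s1 s2
    proof -
      obtain h0 where h0: "h0 > 0"
        "\<And>s h. s1 \<le> s \<Longrightarrow> s \<le> s2 \<Longrightarrow> 0 < h \<Longrightarrow> h < h0 \<Longrightarrow> p s + h *\<^sub>R e \<in> R"
        using push[of s1 s2] s c(2)[of s1] by force
      define k where "k = min h0 (d / (2 * (norm e + 1)))"
      have k: "k > 0" using h0 d by (simp add: k_def add_nonneg_pos)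
      define Eh where "Eh h s = V (p s + h *\<^sub>R e) - fst (p s) *\<^sub>R B - snd (p s) *\<^sub>R C" for h s
      have bound: "norm (Eh h s2 - Eh h s1) \<le> 2 * K * \<epsilon> * (s2 - s1)" if h: "0 < h" "h < k" for h
      proof -
        have inR: "p s + h *\<^sub>R e \<in> R" if "s1 \<le> s" "s \<le> s2" for s
          using h0(2)[of s h] that h by (simp add: k_def)
        have he: "norm (h *\<^sub>R e) < d / 2"
        proof -
          have "norm (h *\<^sub>R e) \<le> h * (norm e + 1)" using h by (simp add: algebra_simps)
          also have "\<dots> < d / (2 * (norm e + 1)) * (norm e + 1)"
            using h by (intro mult_strict_right_mono) (auto simp: k_def add_nonneg_pos)
          also have "\<dots> = d / 2"
            using norm_ge_zero[of e] by (auto simp: field_simps simp del: norm_ge_zero)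
          finally show ?thesis .
        qed
        define E' where "E' s = fst (p' s) *\<^sub>R (pd1 V (p s + h *\<^sub>R e) - B)
            + snd (p' s) *\<^sub>R (pd2 V (p s + h *\<^sub>R e) - C)" for s
        have der: "(Eh h has_vector_derivative E' s) (at s)" if s: "s1 \<le> s" "s \<le> s2" for s
        proof -
          have ps: "(p has_vector_derivative p' s) (at s)"
            using p' c(2)[of s] s \<open>c < s1\<close> \<open>s2 < 0\<close> by force
          have "((\<lambda>s. p s + h *\<^sub>R e) has_vector_derivative p' s) (at s)"
            using has_vector_derivative_add[OF ps has_vector_derivative_const] by simp
          from pd_along_curve[OF _ this, of V] inR[OF s] diff
          have v: "((\<lambda>s. V (p s + h *\<^sub>R e)) has_vector_derivative
             fst (p' s) *\<^sub>R pd1 V (p s + h *\<^sub>R e) + snd (p' s) *\<^sub>R pd2 V (p s + h *\<^sub>R e)) (at s)"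
            by auto
          have f: "((\<lambda>s. fst (p s) *\<^sub>R B) has_vector_derivative fst (p' s) *\<^sub>R B) (at s)"
            "((\<lambda>s. snd (p s) *\<^sub>R C) has_vector_derivative snd (p' s) *\<^sub>R C) (at s)"
            using ps unfolding has_vector_derivative_def
            by (auto intro!: derivative_eq_intros)
          show ?thesis
            unfolding Eh_def E'_def
            by (rule has_vector_derivative_eq_rhs[OF has_vector_derivative_diff[OF
                  has_vector_derivative_diff[OF v f(1)] f(2)]])
               (simp add: algebra_simps)
        qed
        have E'b: "norm (E' s) \<le> 2 * K * \<epsilon>" if s: "s1 \<le> s" "s \<le> s2" for s
        proof -
          have "norm (p s + h *\<^sub>R e) < d"
            using norm_triangle_ineq[of "p s" "h *\<^sub>R e"] he c(2)[of s] s \<open>c < s1\<close> \<open>s2 < 0\<close> by force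
          then have b: "norm (pd1 V (p s + h *\<^sub>R e) - B) \<le> \<epsilon>" "norm (pd2 V (p s + h *\<^sub>R e) - C) \<le> \<epsilon>"
            using d1(2)[OF inR[OF s]] d2(2)[OF inR[OF s]] by (auto simp: d_def intro: less_imp_le)
          have n: "\<bar>fst (p' s)\<bar> \<le> K" "\<bar>snd (p' s)\<bar> \<le> K"
            using norm_fst_le[of "fst (p' s)" "snd (p' s)"] norm_snd_le[of "snd (p' s)" "fst (p' s)"]
              c(2)[of s] s \<open>c < s1\<close> \<open>s2 < 0\<close> by auto
          have "norm (E' s) \<le> \<bar>fst (p' s)\<bar> * norm (pd1 V (p s + h *\<^sub>R e) - B)
              + \<bar>snd (p' s)\<bar> * norm (pd2 V (p s + h *\<^sub>R e) - C)"
            unfolding E'_def using norm_triangle_ineq by (metis norm_scaleR)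
          also have "\<dots> \<le> K * \<epsilon> + K * \<epsilon>"
            by (intro add_mono mult_mono b n) (use K in auto)
          finally show ?thesis by simp
        qed
        have "norm (Eh h s2 - Eh h s1) \<le> 2 * K * \<epsilon> * s2 - 2 * K * \<epsilon> * s1"
        proof (rule differentiable_bound_general[where f' = E' and \<phi>' = "\<lambda>_. 2 * K * \<epsilon>"])
          show "continuous_on {s1..s2} (Eh h)"
            using der has_vector_derivative_continuous
            by (intro continuous_at_imp_continuous_on) fastforce
          show "((\<lambda>s. 2 * K * \<epsilon> * s) has_vector_derivative 2 * K * \<epsilon>) (at s)" for s
            unfolding has_vector_derivative_def by (auto intro!: derivative_eq_intros)
        qed (use s der E'b in \<open>auto intro!: continuous_intros\<close>)
        then show ?thesis by (simp add: algebra_simps)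
      qed
      have "- a < s1" "- a < s2" using c(2)[of s1] c(2)[of s2] s by auto
      then have "((\<lambda>h. Eh h s2 - Eh h s1) \<longlongrightarrow> E s2 - E s1) (at_right 0)"
        unfolding Eh_def E_def using s by (intro tendsto_intros G) auto
      then show ?thesis
        by (rule tendsto_upperbound[OF tendsto_norm])
           (use k bound in \<open>auto simp: eventually_at_right_field intro!: exI[of _ k]\<close>)
    qed
    have est: "norm (A - E s) \<le> 2 * K * \<epsilon> * (0 - s)" if s: "c < s" "s < 0" for s
    proof (rule tendsto_le[OF _ _ tendsto_norm[OF tendsto_diff[OF EA tendsto_const]]])
      show "((\<lambda>s2. 2 * K * \<epsilon> * (s2 - s)) \<longlongrightarrow> 2 * K * \<epsilon> * (0 - s)) (at_left 0)"
        by (intro tendsto_intros)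
      show "\<forall>\<^sub>F s2 in at_left 0. norm (E s2 - E s) \<le> 2 * K * \<epsilon> * (s2 - s)"
        unfolding eventually_at_left_field using s step by (intro exI[of _ s]) auto
    qed auto
    show "\<forall>\<^sub>F s in at_left 0. dist ((1 / s) *\<^sub>R (E s - A)) 0 < \<epsilon>'"
      unfolding eventually_at_left_field
    proof (intro exI[of _ c] conjI allI impI)
      fix s assume s: "c < s" "s < 0"
      have "dist ((1 / s) *\<^sub>R (E s - A)) 0 = norm (A - E s) / (- s)"
        using s by (simp add: dist_norm norm_minus_commute)
      also have "\<dots> \<le> 2 * K * \<epsilon> * (0 - s) / (- s)"
        using est[OF s] s by (intro divide_right_mono) auto
      also have "\<dots> = \<epsilon>' / 2" using s K by (simp add: \<epsilon>_def)
      also have "\<dots> < \<epsilon>'" using \<open>\<epsilon>' > 0\<close> by simp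
      finally show "dist ((1 / s) *\<^sub>R (E s - A)) 0 < \<epsilon>'" .
    qed (use c in auto)
  qed
  moreover have "((\<lambda>s. (1 / s) *\<^sub>R p s) \<longlongrightarrow> q) (at_left 0)"
  proof -
    have "((\<lambda>s. (1 / s) *\<^sub>R p s) \<longlongrightarrow> q) (at 0)"
      using vector_derivative_quotient[OF q] p0 by simp
    then show ?thesis by (metis filterlim_at_split)
  qed
  ultimately have "((\<lambda>s. (1 / s) *\<^sub>R (E s - A) + (fst ((1 / s) *\<^sub>R p s) *\<^sub>R B + snd ((1 / s) *\<^sub>R p s) *\<^sub>R C))
      \<longlongrightarrow> 0 + (fst q *\<^sub>R B + snd q *\<^sub>R C)) (at_left 0)"
    by (intro tendsto_intros)
  then show "((\<lambda>s. (1 / s) *\<^sub>R (G s - A)) \<longlongrightarrow> fst q *\<^sub>R B + snd q *\<^sub>R C) (at_left 0)"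
    by (rule filterlim_cong[THEN iffD1, rotated -1]) (auto simp: E_def algebra_simps)
qed

section \<open>First-order jets of solutions\<close>

text \<open>The system is first order, so at a point it is an algebraic relation between the force \<open>wx\<close>, the state
\<open>v\<close> and its derivatives \<open>a\<close> in \<open>x\<close> and \<open>b\<close> in \<open>t\<close>. In this form it survives the passage to the limit at the
origin, where the solution itself is not defined.\<close>

definition ten_moment_jet :: "real \<Rightarrow> state \<Rightarrow> state \<Rightarrow> state \<Rightarrow> bool" where
  "ten_moment_jet wx v a b \<longleftrightarrow>
     rho b + u1 v * rho a + rho v * u1 a = 0 \<and>
     u1 b + u1 v * u1 a + 1 / rho v * p11 a = - 1 / 2 * wx \<and>
     u2 b + u1 v * u2 a + 1 / rho v * p12 a = 0 \<and>
     p11 b + u1 v * p11 a + 3 * p11 v * u1 a = 0 \<and>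
     p12 b + u1 v * p12 a + 2 * p12 v * u1 a + p11 v * u2 a = 0 \<and>
     p22 b + u1 v * p22 a + p22 v * u1 a + 2 * p12 v * u2 a = 0"

lemma has_derivative_vec_nth [derivative_intros]:
  "(f has_derivative f') F \<Longrightarrow> ((\<lambda>x. f x $ i) has_derivative (\<lambda>x. f' x $ i)) F"
  by (rule bounded_linear.has_derivative[OF bounded_linear_vec_nth])

lemma pd_vec_nth:
  fixes V :: "real \<times> real \<Rightarrow> state"
  assumes "V differentiable (at z)"
  shows "pd1 (\<lambda>y. V y $ i) z = pd1 V z $ i" "pd2 (\<lambda>y. V y $ i) z = pd2 V z $ i"
  using pd_compose[OF assms, of "\<lambda>v. v $ i" "\<lambda>v. v $ i"]
  by (auto intro: bounded_linear_imp_has_derivative)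

lemma ten_moment_jet_at:
  assumes "V differentiable (at z)" "ten_moment_at W V z"
  shows "ten_moment_jet (deriv W (fst z)) (V z) (pd1 V z) (pd2 V z)"
  using assms(2) unfolding ten_moment_at_def ten_moment_jet_def Let_def material_def
    pd_vec_nth[OF assms(1)] by simp

lemma ten_moment_jet_limit:
  assumes F: "F \<noteq> bot" and ev: "\<forall>\<^sub>F z in F. ten_moment_jet (w z) (V z) (a z) (b z)"
    and lim: "(w \<longlongrightarrow> wx) F" "(V \<longlongrightarrow> v) F" "(a \<longlongrightarrow> A) F" "(b \<longlongrightarrow> B) F"
    and v: "rho v \<noteq> 0"
  shows "ten_moment_jet wx v A B"
proof -
  have *: "l = l'" if "(f \<longlongrightarrow> l) F" "(g \<longlongrightarrow> l') F" "\<forall>\<^sub>F z in F. f z = g z"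
    for f g :: "_ \<Rightarrow> real" and l l'
    using tendsto_unique[OF F] tendsto_cong[OF that(3)] that by blast
  have cmp: "((\<lambda>z. V z $ i) \<longlongrightarrow> v $ i) F" "((\<lambda>z. a z $ i) \<longlongrightarrow> A $ i) F"
     "((\<lambda>z. b z $ i) \<longlongrightarrow> B $ i) F" for i
    using lim by (auto intro: tendsto_intros)
  note tends = tendsto_add tendsto_mult tendsto_divide tendsto_const cmp lim(1) v
  have l1: "((\<lambda>z. rho (b z) + u1 (V z) * rho (a z) + rho (V z) * u1 (a z)) \<longlongrightarrow> rho B + u1 v * rho A + rho v * u1 A) F"
    by (intro tends)
  have l2: "((\<lambda>z. u1 (b z) + u1 (V z) * u1 (a z) + 1 / rho (V z) * p11 (a z)) \<longlongrightarrow> u1 B + u1 v * u1 A + 1 / rho v * p11 A) F"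
    by (intro tends)
  have l3: "((\<lambda>z. u2 (b z) + u1 (V z) * u2 (a z) + 1 / rho (V z) * p12 (a z)) \<longlongrightarrow> u2 B + u1 v * u2 A + 1 / rho v * p12 A) F"
    by (intro tends)
  have l4: "((\<lambda>z. p11 (b z) + u1 (V z) * p11 (a z) + 3 * p11 (V z) * u1 (a z)) \<longlongrightarrow> p11 B + u1 v * p11 A + 3 * p11 v * u1 A) F"
    by (intro tends)
  have l5: "((\<lambda>z. p12 (b z) + u1 (V z) * p12 (a z) + 2 * p12 (V z) * u1 (a z) + p11 (V z) * u2 (a z)) \<longlongrightarrow> p12 B + u1 v * p12 A + 2 * p12 v * u1 A + p11 v * u2 A) F"
    by (intro tends)
  have l6: "((\<lambda>z. p22 (b z) + u1 (V z) * p22 (a z) + p22 (V z) * u1 (a z) + 2 * p12 (V z) * u2 (a z)) \<longlongrightarrow> p22 B + u1 v * p22 A + p22 v * u1 A + 2 * p12 v * u2 A) F"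
    by (intro tends)
  have lw: "((\<lambda>z. - 1 / 2 * w z) \<longlongrightarrow> - 1 / 2 * wx) F"
    by (intro tends)
  have ev': "\<forall>\<^sub>F z in F. f z = g z" if "\<And>z. ten_moment_jet (w z) (V z) (a z) (b z) \<Longrightarrow> f z = g z" for f g :: "_ \<Rightarrow> real"
    using that by (rule eventually_mono[OF ev])
  note eq = *[OF l1 tendsto_const ev'] *[OF l2 lw ev'] *[OF l3 tendsto_const ev'] *[OF l4 tendsto_const ev']
    *[OF l5 tendsto_const ev'] *[OF l6 tendsto_const ev']
  show ?thesis
    unfolding ten_moment_jet_def by (intro conjI eq) (simp_all only: ten_moment_jet_def)
qed

section \<open>Differentials of the Riemann invariants\<close>

lemma sound_pos: "admissible v \<Longrightarrow> sound v > 0"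
  by (auto simp: sound_def admissible_def)

lemma sound_squared: "admissible v \<Longrightarrow> (sound v)\<^sup>2 = 3 * p11 v / rho v"
  by (auto simp: sound_def admissible_def)

lemma S1_has_derivative:
  assumes "admissible v" shows "(S1 has_derivative S1_prime v) (at v)"
proof -
  have r: "rho v \<noteq> 0" using assms by (simp add: admissible_def)
  show ?thesis
    unfolding S1_def[abs_def] S1_prime_def[abs_def] sound_squared[OF assms]
    by (rule derivative_eq_intros refl | simp add: r)+
       (use r in \<open>auto simp: fun_eq_iff field_simps power_eq_if\<close>)
qed

lemma S2_has_derivative:
  assumes "admissible v" shows "(S2 has_derivative S2_prime v) (at v)"
proof -
  have r: "rho v \<noteq> 0" using assms by (simp add: admissible_def)
  show ?thesis
    unfolding S2_def[abs_def] S2_prime_def[abs_def] detp_def[abs_def]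
    by (rule derivative_eq_intros refl | simp add: r)+
       (use r in \<open>auto simp: fun_eq_iff field_simps power_eq_if\<close>)
qed

lemma psi3_has_derivative:
  assumes "admissible v" shows "(psi3 has_derivative psi3_prime v) (at v)"
proof -
  have r: "rho v \<noteq> 0" using assms by (simp add: admissible_def)
  show ?thesis
    unfolding psi3_def[abs_def] psi3_prime_def[abs_def]
    by (rule derivative_eq_intros refl | simp add: r)+
       (use r in \<open>auto simp: fun_eq_iff field_simps power_eq_if\<close>)
qed

lemma psi2_has_derivative:
  assumes "admissible v" shows "(psi2 has_derivative psi2_prime v) (at v)"
proof -
  have r: "rho v > 0" "p11 v > 0" using assms by (auto simp: admissible_def)
  then have rp: "0 < rho v * p11 v" by simp
  define s where "s = sqrt (rho v * p11 v)"
  have s: "s > 0" "s * s = rho v * p11 v" using rp r by (auto simp: s_def simp flip: real_sqrt_mult)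
  have d: "((\<lambda>w. sqrt 3 * p12 w / sqrt (rho w * p11 w)) has_derivative
      (\<lambda>d. (sqrt 3 * p12 d * s - sqrt 3 * p12 v * ((rho d * p11 v + rho v * p11 d) / (2 * s))) / (s * s))) (at v)"
    unfolding s_def
    by (rule has_derivative_eq_rhs, (rule derivative_intros rp | (use r in simp; fail))+)
       (fold s_def, use s(1) in \<open>simp add: fun_eq_iff field_simps\<close>)
  have "(sqrt 3 * p12 d * s - sqrt 3 * p12 v * ((rho d * p11 v + rho v * p11 d) / (2 * s))) / (s * s) =
     sqrt 3 / s * p12 d - sqrt 3 * p12 v / (2 * rho v * s) * rho d
       - sqrt 3 * p12 v / (2 * p11 v * s) * p11 d" for d
  proof -
    have "x * s / (s * s) = x / s" "x * (y / (2 * s)) / (s * s) = x * y / (2 * s * (s * s))" for x y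
      using s(1) by simp_all
    then have "(sqrt 3 * p12 d * s - sqrt 3 * p12 v * ((rho d * p11 v + rho v * p11 d) / (2 * s))) / (s * s) =
      sqrt 3 * p12 d / s - sqrt 3 * p12 v * (rho d * p11 v + rho v * p11 d) / (2 * s * (rho v * p11 v))"
      by (simp only: diff_divide_distrib s(2))
    also have "\<dots> = sqrt 3 / s * p12 d - sqrt 3 * p12 v / (2 * rho v * s) * rho d
       - sqrt 3 * p12 v / (2 * p11 v * s) * p11 d"
      using s(1) r by (simp add: field_simps)
    finally show ?thesis .
  qed
  then show ?thesis
    unfolding psi2_def[abs_def] psi2_prime_def[abs_def] s_def[symmetric]
    by (intro has_derivative_eq_rhs[OF has_derivative_add[OF
          bounded_linear_imp_has_derivative[OF bounded_linear_vec_nth] d]])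
       (simp add: fun_eq_iff)
qed

section \<open>Entropies\<close>

text \<open>Of the 1-Riemann invariants, \<open>S1\<close> and \<open>S2\<close> are distinguished by having no source: the system transports
them along particle paths. The differential \<open>S'\<close> is a parameter
because its value on the initial slope is the given left datum.\<close>

locale entropy =
  fixes S :: "state \<Rightarrow> real" and S' :: "state \<Rightarrow> state \<Rightarrow> real"
  assumes derivative: "admissible v \<Longrightarrow> (S has_derivative S' v) (at v)"
    and derivative_smooth: "admissible v \<Longrightarrow> (\<lambda>w. S' (fst w) (snd w)) differentiable (at (v, d))"
    and transported: "admissible v \<Longrightarrow> ten_moment_jet wx v a b \<Longrightarrow> S' v b = - u1 v * S' v a"

lemma entropy_S1: "entropy S1 S1_prime"
proof
  fix v d :: state
  assume v: "admissible v"
  have r: "rho v \<noteq> 0" "3 * p11 v / rho v > 0" using v by (simp_all add: admissible_def)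
  show "(\<lambda>w. S1_prime (fst w) (snd w)) differentiable at (v, d)"
    unfolding S1_prime_def sound_def differentiable_def
    by (rule exI, (rule derivative_eq_intros refl | (simp add: r; fail))+)
next
  fix wx v a b assume v: "admissible v" and j: "ten_moment_jet wx v a b"
  have r: "rho v \<noteq> 0" using v by (simp add: admissible_def)
  have "rho b = - u1 v * rho a - rho v * u1 a" "p11 b = - u1 v * p11 a - 3 * p11 v * u1 a"
    using j by (auto simp: ten_moment_jet_def)
  then show "S1_prime v b = - u1 v * S1_prime v a"
    unfolding S1_prime_def sound_squared[OF v] using r by (simp only:) (simp add: field_simps)
qed (rule S1_has_derivative)

lemma entropy_S2: "entropy S2 S2_prime"
proof
  fix v d :: state
  assume v: "admissible v"
  have r: "rho v \<noteq> 0" using v by (simp add: admissible_def)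
  show "(\<lambda>w. S2_prime (fst w) (snd w)) differentiable at (v, d)"
    unfolding S2_prime_def detp_def differentiable_def
    by (rule exI, (rule derivative_eq_intros refl | (simp add: r; fail))+)
next
  fix wx v a b assume v: "admissible v" and j: "ten_moment_jet wx v a b"
  have r: "rho v \<noteq> 0" using v by (simp add: admissible_def)
  have "rho b = - u1 v * rho a - rho v * u1 a" "p11 b = - u1 v * p11 a - 3 * p11 v * u1 a"
    "p12 b = - u1 v * p12 a - 2 * p12 v * u1 a - p11 v * u2 a"
    "p22 b = - u1 v * p22 a - p22 v * u1 a - 2 * p12 v * u2 a"
    using j by (auto simp: ten_moment_jet_def)
  then show "S2_prime v b = - u1 v * S2_prime v a"
    unfolding S2_prime_def detp_def
    using r by (simp only:) (simp add: divide_simps, simp add: algebra_simps eval_nat_numeral)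
qed (rule S2_has_derivative)

section \<open>The two linear equations\<close>

text \<open>The system determines the \<open>x\<close>-derivatives of all components but \<open>\<rho>\<close> and \<open>p22\<close> from material
derivatives and the force.
The missing information on \<open>\<rho>\<close> is the derivative of the entropy \<open>S1\<close>.\<close>

lemma jet_x_derivatives:
  assumes v: "admissible v" and j: "ten_moment_jet wx v a b"
  shows "u1 a = - (p11 b + u1 v * p11 a) / (3 * p11 v)"
    and "p11 a = - rho v * (u1 b + u1 v * u1 a + 1 / 2 * wx)"
    and "p12 a = - rho v * (u2 b + u1 v * u2 a)"
    and "u2 a = - (p12 b + u1 v * p12 a - 2 * p12 v / (3 * p11 v) * (p11 b + u1 v * p11 a)) / p11 v"
    and "S1_prime v a = \<sigma> * sound v \<Longrightarrow>
      rho a = - rho v / (sound v)\<^sup>2 * (u1 b + u1 v * u1 a + 1 / 2 * wx) - rho v ^ 3 * \<sigma> / sound v"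
proof -
  have r: "rho v > 0" "p11 v > 0" using v by (auto simp: admissible_def)
  have c: "sound v > 0" using v by (rule sound_pos)
  have e: "u1 b + u1 v * u1 a + 1 / rho v * p11 a = - 1 / 2 * wx"
     "u2 b + u1 v * u2 a + 1 / rho v * p12 a = 0"
     "p11 b + u1 v * p11 a + 3 * p11 v * u1 a = 0"
     "p12 b + u1 v * p12 a + 2 * p12 v * u1 a + p11 v * u2 a = 0"
    using j by (auto simp: ten_moment_jet_def)
  have e3: "p11 b + u1 v * p11 a = - 3 * p11 v * u1 a" using e(3) by linarith
  show "u1 a = - (p11 b + u1 v * p11 a) / (3 * p11 v)"
    unfolding e3 using r by simp
  have e1: "u1 b + u1 v * u1 a + 1 / 2 * wx = - p11 a / rho v" using e(1) by simp
  show "p11 a = - rho v * (u1 b + u1 v * u1 a + 1 / 2 * wx)"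
    unfolding e1 using r by simp
  have e2: "u2 b + u1 v * u2 a = - p12 a / rho v" using e(2) by simp
  show "p12 a = - rho v * (u2 b + u1 v * u2 a)"
    unfolding e2 using r by simp
  have e4: "p12 b + u1 v * p12 a = - 2 * p12 v * u1 a - p11 v * u2 a" using e(4) by linarith
  show "u2 a = - (p12 b + u1 v * p12 a - 2 * p12 v / (3 * p11 v) * (p11 b + u1 v * p11 a)) / p11 v"
    unfolding e4 e3 using r by (simp add: field_simps)
  assume "S1_prime v a = \<sigma> * sound v"
  then have "p11 a - (sound v)\<^sup>2 * rho a = rho v ^ 3 * \<sigma> * sound v"
    using r by (simp add: S1_prime_def field_simps)
  then have "rho a = (p11 a - rho v ^ 3 * \<sigma> * sound v) / (sound v)\<^sup>2"
    using c by (simp add: field_simps)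
  then show "rho a = - rho v / (sound v)\<^sup>2 * (u1 b + u1 v * u1 a + 1 / 2 * wx) - rho v ^ 3 * \<sigma> / sound v"
    unfolding e1 using r c by (simp add: diff_divide_distrib power2_eq_square)
qed

text \<open>The factors multiplied by \<open>qL vl vs / (2 * sound vs)\<close> in \<open>d3\<close> and \<open>d4\<close> are what remains of \<open>Pi2\<close> and \<open>Pi3\<close> when the
multiples of the unknown material derivatives of \<open>u2\<close> and \<open>p12\<close> are split off.\<close>

lemma Pi_jet:
  assumes v: "admissible v" and j: "ten_moment_jet wx v a b" and S: "S1_prime v a = \<sigma> * sound v"
  shows "Pi2 v a = - 2 * (u2 b + u1 v * u2 a)
      + (2 * p12 v / p11 v * (u1 b + u1 v * u1 a + 1 / 2 * wx)
        + \<sigma> * (sound v * (rho v)\<^sup>2 * p12 v / (2 * p11 v)))"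
    and "Pi3 v a = - sound v / (rho v)\<^sup>2 * (u2 b + u1 v * u2 a)
      + 1 / rho v ^ 3 * (p12 b + u1 v * p12 a)
      + (1 / rho v ^ 3 * (- (p12 v / p11 v) * (p11 b + u1 v * p11 a)
            + 3 * p12 v / sound v * (u1 b + u1 v * u1 a + 1 / 2 * wx))
        + \<sigma> * (3 * p12 v / rho v))"
proof -
  have r: "rho v > 0" "p11 v > 0" using v by (auto simp: admissible_def)
  have c: "sound v > 0" using v by (rule sound_pos)
  \<comment> \<open>In the variables \<open>\<rho>\<close> and \<open>c\<close> both identities become rational.\<close>
  have p: "p11 v = rho v * (sound v)\<^sup>2 / 3" using sound_squared[OF v] r by simp
  define E where "E = u1 b + u1 v * u1 a + 1 / 2 * wx"
  define D2 where "D2 = u2 b + u1 v * u2 a"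
  define D4 where "D4 = p11 b + u1 v * p11 a"
  define D5 where "D5 = p12 b + u1 v * p12 a"
  note x = jet_x_derivatives[OF v j, folded E_def D2_def D4_def D5_def]
  note xr = x(5)[OF S]
  show "Pi2 v a = - 2 * (u2 b + u1 v * u2 a)
      + (2 * p12 v / p11 v * (u1 b + u1 v * u1 a + 1 / 2 * wx)
        + \<sigma> * (sound v * (rho v)\<^sup>2 * p12 v / (2 * p11 v)))"
    unfolding E_def[symmetric] D2_def[symmetric]
    unfolding Pi2_def xr x(2,3) p
    using r(1) c by (simp add: divide_simps, simp add: algebra_simps eval_nat_numeral)
  show "Pi3 v a = - sound v / (rho v)\<^sup>2 * (u2 b + u1 v * u2 a)
      + 1 / rho v ^ 3 * (p12 b + u1 v * p12 a)
      + (1 / rho v ^ 3 * (- (p12 v / p11 v) * (p11 b + u1 v * p11 a)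
            + 3 * p12 v / sound v * (u1 b + u1 v * u1 a + 1 / 2 * wx))
        + \<sigma> * (3 * p12 v / rho v))"
    unfolding E_def[symmetric] D2_def[symmetric] D4_def[symmetric] D5_def[symmetric]
    unfolding Pi3_def xr x(1,3,4) p
    using r(1) c by (simp add: divide_simps, simp add: algebra_simps eval_nat_numeral)
qed

text \<open>The convective terms are rewritten through material derivatives. The left-hand sides
also occur inside the brackets on the right, so as rewrite rules these equations would loop.\<close>

lemma jet_t_derivatives:
  assumes v: "admissible v" and j: "ten_moment_jet wx v a b"
  shows "u2 b = (u2 b + u1 v * u2 a) + u1 v / p11 v *
      ((p12 b + u1 v * p12 a) - 2 * p12 v / (3 * p11 v) * (p11 b + u1 v * p11 a))"
    and "p12 b = (p12 b + u1 v * p12 a) + rho v * u1 v * (u2 b + u1 v * u2 a)"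
proof -
  have r: "rho v > 0" "p11 v > 0" using v by (auto simp: admissible_def)
  note x = jet_x_derivatives[OF v j]
  have "u1 v * u2 a = - (u1 v / p11 v *
      ((p12 b + u1 v * p12 a) - 2 * p12 v / (3 * p11 v) * (p11 b + u1 v * p11 a)))"
    by (subst x(4)) (simp add: right_diff_distrib diff_divide_distrib)
  then show "u2 b = (u2 b + u1 v * u2 a) + u1 v / p11 v *
      ((p12 b + u1 v * p12 a) - 2 * p12 v / (3 * p11 v) * (p11 b + u1 v * p11 a))" by linarith
  have "u1 v * p12 a = - (rho v * u1 v * (u2 b + u1 v * u2 a))"
    by (subst x(3)) simp
  then show "p12 b = (p12 b + u1 v * p12 a) + rho v * u1 v * (u2 b + u1 v * u2 a)" by linarith
qed

text \<open>The quadrature relation for \<open>psi2\<close> becomes a linear equation for the two unknown material derivatives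
once every other derivative in it is expressed through known quantities.\<close>

lemma psi2_quadrature_coefficients:
  assumes v: "admissible v" and j: "ten_moment_jet wx v a b"
    and S: "S1_prime v a = S1_prime vl dl / sound vl * sound v"
    and E: "Du1 = u1 b + u1 v * u1 a" "Du2 = u2 b + u1 v * u2 a"
      "Dp11 = p11 b + u1 v * p11 a" "Dp12 = p12 b + u1 v * p12 a"
    and q: "psi2_prime v b = (kappa2 vl dl + Pi2 vl dl / (8 * sound vl) * (lam1 v - lam1 vl)) * psi1 vl
         + qL vl v / (2 * sound v) * Pi2 v a"
  shows "a3 vl v * Du2 + b3 v * Dp12 = d3 vl dl v wx Du1 Dp11 (rho b) (p11 b)"
proof -
  have r: "rho v > 0" "p11 v > 0" using v by (auto simp: admissible_def)
  have c: "sound v > 0" using v by (rule sound_pos)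
  define k where "k = sqrt 3 / sqrt (rho v * p11 v)"
  have k: "sqrt 3 * x / (y * sqrt (rho v * p11 v)) = k * (x / y)"
    "sqrt 3 * x / sqrt (rho v * p11 v) = k * x" for x y
    by (simp_all add: k_def)
  note P = Pi_jet(1)[OF v j S, folded E]
  note t = jet_t_derivatives[OF v j, folded E]
  define Q where "Q = qL vl v / (2 * sound v)"
  have Q: "qL vl v / sound v = 2 * Q" by (simp add: Q_def)
  define Z where "Z = 2 * p12 v / p11 v * (Du1 + 1 / 2 * wx)
        + S1_prime vl dl / sound vl * (sound v * (rho v)\<^sup>2 * p12 v / (2 * p11 v))"
  define M where "M = (kappa2 vl dl + Pi2 vl dl / (8 * sound vl) * (lam1 v - lam1 vl)) * psi1 vl"
  have "psi2_prime v b = M + Q * (- 2 * Du2 + Z)"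
    using q P by (simp add: Q_def Z_def M_def)
  moreover have "psi2_prime v b = u2 b + k * p12 b - k * (p12 v / (2 * rho v)) * rho b - k * (p12 v / (2 * p11 v)) * p11 b"
    unfolding psi2_prime_def k k_def by simp
  ultimately show ?thesis
    unfolding a3_def b3_def d3_def mult.assoc[of "sqrt 3"] k Q M_def[symmetric] Z_def[symmetric] Q_def[symmetric] k_def[symmetric]
    using t r by (simp add: field_simps power2_eq_square)
qed

lemma psi3_quadrature_coefficients:
  assumes v: "admissible v" and j: "ten_moment_jet wx v a b"
    and S: "S1_prime v a = S1_prime vl dl / sound vl * sound v"
    and E: "Du1 = u1 b + u1 v * u1 a" "Du2 = u2 b + u1 v * u2 a"
      "Dp11 = p11 b + u1 v * p11 a" "Dp12 = p12 b + u1 v * p12 a"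
    and q: "psi3_prime v b = (kappa3 vl dl + Pi3 vl dl / (8 * sound vl) * (lam1 v - lam1 vl)) * psi1 vl
         + qL vl v / (2 * sound v) * Pi3 v a"
  shows "a4 vl v * Du2 + b4 vl v * Dp12 = d4 vl dl v wx Du1 Dp11 (rho b)"
proof -
  have r: "rho v > 0" "p11 v > 0" using v by (auto simp: admissible_def)
  have c: "sound v > 0" using v by (rule sound_pos)
  note P = Pi_jet(2)[OF v j S, folded E]
  note t = jet_t_derivatives(2)[OF v j, folded E]
  define Q where "Q = qL vl v / (2 * sound v)"
  have Q: "qL vl v / 2 = Q * sound v" using c by (simp add: Q_def)
  define Z where "Z = 1 / rho v ^ 3 * (- (p12 v / p11 v) * Dp11
            + 3 * p12 v / sound v * (Du1 + 1 / 2 * wx))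
        + S1_prime vl dl / sound vl * (3 * p12 v / rho v)"
  define M where "M = (kappa3 vl dl + Pi3 vl dl / (8 * sound vl) * (lam1 v - lam1 vl)) * psi1 vl"
  have "psi3_prime v b = M + Q * (- sound v / (rho v)\<^sup>2 * Du2 + 1 / rho v ^ 3 * Dp12 + Z)"
    using q P by (simp add: Q_def Z_def M_def)
  moreover have "psi3_prime v b = Dp12 / rho v ^ 3 + u1 v / (rho v)\<^sup>2 * Du2 - 3 * p12 v / rho v ^ 4 * rho b"
    unfolding psi3_prime_def by (subst t) (use r in \<open>simp add: field_simps eval_nat_numeral\<close>)
  ultimately have "Dp12 / rho v ^ 3 + u1 v / (rho v)\<^sup>2 * Du2 - 3 * p12 v / rho v ^ 4 * rho b
    = M + Q * (- sound v / (rho v)\<^sup>2 * Du2 + 1 / rho v ^ 3 * Dp12 + Z)" by simp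
  then show ?thesis
    unfolding a4_def b4_def d4_def Q M_def[symmetric] Z_def[symmetric] Q_def[symmetric]
    by (simp add: algebra_simps add_divide_distrib diff_divide_distrib)
qed

lemma cramer_2:
  fixes a b c d x y e f :: real
  assumes "a * x + b * y = e" "c * x + d * y = f" "a * d - c * b \<noteq> 0"
  shows "x = (e * d - f * b) / (a * d - c * b)" "y = (e * c - f * a) / (b * c - d * a)"
proof -
  have "x * (a * d - c * b) = e * d - f * b" unfolding assms(1,2)[symmetric] by (simp add: algebra_simps)
  then show "x = (e * d - f * b) / (a * d - c * b)" using assms(3) by (simp add: eq_divide_eq)
  have "y * (b * c - d * a) = e * c - f * a" unfolding assms(1,2)[symmetric] by (simp add: algebra_simps)
  moreover have "b * c - d * a \<noteq> 0" using assms(3) by (simp add: algebra_simps)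
  ultimately show "y = (e * c - f * a) / (b * c - d * a)" by (simp add: eq_divide_eq)
qed

section \<open>The rarefaction fan at its vertex\<close>

lemma open_admissible: "open {v. admissible v}"
  unfolding admissible_def detp_def
  by (intro open_Collect_conj open_Collect_less continuous_intros)

lemma C2_on_open:
  assumes "C2_on f U" "open U" "z \<in> U"
  shows "f differentiable (at z)" "pd1 f differentiable (at z)" "pd2 f differentiable (at z)"
  using assms by (simp_all add: C2_on_def C1_on_def differentiable_on_eq_differentiable_at)

lemma differentiable_transform_open:
  assumes "f differentiable (at z)" "open U" "z \<in> U" "\<And>w. w \<in> U \<Longrightarrow> f w = g w"
  shows "g differentiable (at z)"
  using assms unfolding differentiable_def by (blast intro: has_derivative_transform_within_open)

lemma psi1_differentiable: "admissible v \<Longrightarrow> psi1 differentiable (at v)"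
proof -
  assume "admissible v"
  then have r: "rho v \<noteq> 0" "3 * p11 v / rho v > 0" by (simp_all add: admissible_def)
  have nth: "(\<lambda>w. w $ i) differentiable (at v)" for i :: 6
    by (rule bounded_linear_imp_differentiable) (rule bounded_linear_vec_nth)
  have quot: "(\<lambda>w. 3 * p11 w / rho w) differentiable (at v)"
    using nth r by (intro differentiable_divide differentiable_mult differentiable_const) auto
  have "sqrt differentiable (at (3 * p11 v / rho v))"
    using DERIV_real_sqrt[OF r(2)] by (auto simp: differentiable_def has_field_derivative_def)
  from differentiable_compose[OF this quot] show ?thesis
    unfolding psi1_def[abs_def] sound_def[abs_def] by (intro differentiable_add nth)
qed

lemma (in entropy) linear: "admissible v \<Longrightarrow> linear (S' v)"
  using derivative has_derivative_linear by blast

context rarefaction_fan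
begin

lemma smooth_neighbourhood:
  obtains U where "open U" "{- \<alpha>0..0} \<times> {\<beta>L..\<beta>s} \<subseteq> U"
    "\<And>z. z \<in> U \<Longrightarrow> admissible (F z)"
    "\<And>z. z \<in> U \<Longrightarrow> X differentiable (at z) \<and> pd1 X differentiable (at z) \<and> pd2 X differentiable (at z)"
    "\<And>z. z \<in> U \<Longrightarrow> Y differentiable (at z) \<and> pd1 Y differentiable (at z) \<and> pd2 Y differentiable (at z)"
    "\<And>z. z \<in> U \<Longrightarrow> F differentiable (at z) \<and> pd1 F differentiable (at z) \<and> pd2 F differentiable (at z)"
proof -
  obtain U where U: "open U" "{- \<alpha>0..0} \<times> {\<beta>L..\<beta>s} \<subseteq> U" "C2_on X U" "C2_on Y U" "C2_on F U"
    using smooth by blast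
  have "continuous_on U F"
    using C2_on_open(1)[OF U(5,1)] differentiable_imp_continuous_within
    by (intro continuous_at_imp_continuous_on) blast
  then have "open (U \<inter> F -` {v. admissible v})"
    using continuous_open_preimage U(1) open_admissible by blast
  then show thesis
    using U admissible C2_on_open[OF U(3,1)] C2_on_open[OF U(4,1)] C2_on_open[OF U(5,1)]
    by (intro that[of "U \<inter> F -` {v. admissible v}"]) auto
qed

lemma fan_differentiable:
  assumes "z \<in> {- \<alpha>0..0} \<times> {\<beta>L..\<beta>s}"
  shows "X differentiable (at z)" "pd1 X differentiable (at z)" "pd2 X differentiable (at z)"
    "Y differentiable (at z)" "pd1 Y differentiable (at z)" "pd2 Y differentiable (at z)"
    "F differentiable (at z)" "pd1 F differentiable (at z)" "pd2 F differentiable (at z)"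
  using smooth_neighbourhood assms by (metis subsetD)+

text \<open>The curve with parameter \<open>\<beta>\<close> is a characteristic of speed \<open>u1 - c\<close> and leaves the origin with slope \<open>\<beta>\<close>.\<close>

lemma lam1_at_vertex:
  assumes "\<beta> \<in> {\<beta>L..\<beta>s}"
  shows "lam1 (F (0, \<beta>)) = \<beta>"
proof -
  have z: "(0, \<beta>) \<in> {- \<alpha>0..0} \<times> {\<beta>L..\<beta>s}" using assms ranges by auto
  then have "(lam1 (F (0, \<beta>)) - \<beta>) * pd1 Y (0, \<beta>) = 0"
    using characteristic_minus[OF z] slope[OF assms] by (simp add: lam1_def algebra_simps)
  then show ?thesis using nondegenerate[OF z] by simp
qed

lemma sound_at_vertex:
  assumes "\<beta> \<in> {\<beta>L..\<beta>s}"
  shows "2 * sound (F (0, \<beta>)) = psi1 VL - \<beta>"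
  using lam1_at_vertex[OF assms] invariants_at_origin[OF _ assms, of psi1]
  by (simp add: lam1_def psi1_def)

lemma Y_beta_at_vertex:
  assumes b: "\<beta>L < \<beta>" "\<beta> < \<beta>s"
  shows "pd2 Y (0, \<beta>) = 0"
proof -
  have z: "(0, \<beta>) \<in> {- \<alpha>0..0} \<times> {\<beta>L..\<beta>s}" using b ranges by auto
  have "((\<lambda>s. Y (0, s)) has_vector_derivative 0) (at \<beta>)"
    by (rule has_vector_derivative_transform_within_open[OF has_vector_derivative_const[of 0],
          where S = "{\<beta>L<..<\<beta>s}"]) (use b origin in auto)
  then show ?thesis
    unfolding pd2_def fst_conv snd_conv by (rule vector_derivative_at)
qed

lemma constant_along_vertex:
  fixes g :: "real \<Rightarrow> real"
  assumes "continuous_on {\<beta>L..\<beta>s} g"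
    and "\<And>\<beta>. \<beta>L < \<beta> \<Longrightarrow> \<beta> < \<beta>s \<Longrightarrow> (g has_real_derivative 0) (at \<beta>)"
  shows "g \<beta>s = g \<beta>L"
  using DERIV_isconst_end[OF ranges(2) assms] by simp

lemma mixed_pd_fan:
  assumes z: "z \<in> {- \<alpha>0..0} \<times> {\<beta>L..\<beta>s}"
  shows "pd1 (pd2 Y) z = pd2 (pd1 Y) z" "pd1 (pd2 X) z = pd2 (pd1 X) z"
proof -
  obtain U where U: "open U" "{- \<alpha>0..0} \<times> {\<beta>L..\<beta>s} \<subseteq> U"
    "\<And>z. z \<in> U \<Longrightarrow> X differentiable (at z)" "\<And>z. z \<in> U \<Longrightarrow> Y differentiable (at z)"
    using smooth_neighbourhood by metis
  show "pd1 (pd2 Y) z = pd2 (pd1 Y) z" "pd1 (pd2 X) z = pd2 (pd1 X) z"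
    using U z fan_differentiable[OF z] by (auto intro!: mixed_pd_symmetric[OF U(1)])
qed

text \<open>The scale \<open>t\<^sub>\<alpha>\<close> at the vertex is proportional to \<open>1 / c\<close>. Differentiating \<open>x\<^sub>\<beta> = (u1 + c) t\<^sub>\<beta>\<close> in \<open>\<alpha>\<close> at
\<open>\<alpha> = 0\<close>, where \<open>t\<^sub>\<beta> = 0\<close> and \<open>u1 + c\<close> has its left value \<open>\<psi>\<close>, gives \<open>x\<^sub>\<alpha>\<^sub>\<beta> = \<psi> t\<^sub>\<alpha>\<^sub>\<beta>\<close>; differentiating
\<open>x\<^sub>\<alpha> = \<beta> t\<^sub>\<alpha>\<close> in \<open>\<beta>\<close> gives \<open>x\<^sub>\<alpha>\<^sub>\<beta> = t\<^sub>\<alpha> + \<beta> t\<^sub>\<alpha>\<^sub>\<beta>\<close>. Hence \<open>(\<psi> - \<beta>) t\<^sub>\<alpha>\<close> is constant in \<open>\<beta>\<close>, and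
\<open>\<psi> - \<beta> = 2 c\<close>.\<close>

lemma sound_times_time_scale:
  "sound (F (0, \<beta>s)) * pd1 Y (0, \<beta>s) = sound (F (0, \<beta>L)) * pd1 Y (0, \<beta>L)"
proof -
  define g where "g \<beta> = (psi1 VL - \<beta>) * pd1 Y (0, \<beta>)" for \<beta>
  have K: "(0, \<beta>) \<in> {- \<alpha>0..0} \<times> {\<beta>L..\<beta>s}" if "\<beta> \<in> {\<beta>L..\<beta>s}" for \<beta>
    using that ranges by auto
  have "g \<beta>s = g \<beta>L"
  proof (rule constant_along_vertex)
    have "isCont (\<lambda>s. pd1 Y (0, s)) \<beta>" if "\<beta> \<in> {\<beta>L..\<beta>s}" for \<beta>
      using pd_has_real_derivative(2)[OF fan_differentiable(5)[OF K[OF that]]] DERIV_isCont by blast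
    then show "continuous_on {\<beta>L..\<beta>s} g"
      unfolding g_def[abs_def]
      by (intro continuous_intros continuous_at_imp_continuous_on) auto
  next
    fix \<beta> assume b: "\<beta>L < \<beta>" "\<beta> < \<beta>s"
    then have b': "\<beta> \<in> {\<beta>L..\<beta>s}" by auto
    note D = fan_differentiable[OF K[OF b']]
    have adm: "admissible (F (0, \<beta>))" using admissible K[OF b'] by blast
    define m where "m = pd2 (pd1 Y) (0, \<beta>)"
    have psi: "(\<lambda>z. psi1 (F z)) differentiable (at (0, \<beta>))"
      using differentiable_compose[OF psi1_differentiable[OF adm] D(7)] by simp
    have "((\<lambda>s. pd2 X (s, \<beta>) - psi1 (F (s, \<beta>)) * pd2 Y (s, \<beta>)) has_real_derivative
        pd1 (pd2 X) (0, \<beta>) - (pd1 (\<lambda>z. psi1 (F z)) (0, \<beta>) * pd2 Y (0, \<beta>)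
          + pd1 (pd2 Y) (0, \<beta>) * psi1 (F (0, \<beta>)))) (at 0)"
      by (intro DERIV_diff DERIV_mult pd_has_real_derivative(1)[OF D(3)] pd_has_real_derivative(1)[OF D(6)] pd_has_real_derivative(1)[OF psi])
    moreover have "pd2 X (s, \<beta>) - psi1 (F (s, \<beta>)) * pd2 Y (s, \<beta>) = 0" if "- \<alpha>0 < s" "s \<le> 0" for s
      using characteristic_plus[of "(s, \<beta>)"] that b by (simp add: psi1_def)
    ultimately have "pd1 (pd2 X) (0, \<beta>) - (pd1 (\<lambda>z. psi1 (F z)) (0, \<beta>) * pd2 Y (0, \<beta>)
          + pd1 (pd2 Y) (0, \<beta>) * psi1 (F (0, \<beta>))) = 0"
      using derivative_zero_if_zero_left ranges(1) by blast
    then have X: "pd2 (pd1 X) (0, \<beta>) = psi1 VL * m"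
      using Y_beta_at_vertex[OF b] mixed_pd_fan[OF K[OF b']] invariants_at_origin[OF _ b', of psi1]
      by (simp add: m_def)
    have "((\<lambda>s. s * pd1 Y (0, s)) has_real_derivative 1 * pd1 Y (0, \<beta>) + m * \<beta>) (at \<beta>)"
      unfolding m_def by (intro DERIV_mult pd_has_real_derivative(2)[OF D(5)] DERIV_ident)
    then have "((\<lambda>s. pd1 X (0, s)) has_real_derivative 1 * pd1 Y (0, \<beta>) + m * \<beta>) (at \<beta>)"
      by (rule has_field_derivative_transform_within_open[where S = "{\<beta>L<..<\<beta>s}"]) (use b slope in auto)
    then have "pd1 Y (0, \<beta>) + m * \<beta> = psi1 VL * m"
      using DERIV_unique[OF pd_has_real_derivative(2)[OF D(2)]] X by simp
    moreover have "(g has_real_derivative (0 - 1) * pd1 Y (0, \<beta>) + m * (psi1 VL - \<beta>)) (at \<beta>)"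
      unfolding g_def[abs_def] m_def
      by (intro DERIV_mult pd_has_real_derivative(2)[OF D(5)] DERIV_diff DERIV_ident DERIV_const)
    ultimately show "(g has_real_derivative 0) (at \<beta>)" by (simp add: algebra_simps)
  qed
  then show ?thesis
    using sound_at_vertex[of \<beta>s] sound_at_vertex[of \<beta>L] ranges(2)
    by (simp add: g_def) (metis mult.assoc mult_cancel_left zero_neq_numeral)
qed

lemma pd_F_interior:
  assumes z: "z \<in> {- \<alpha>0<..<0} \<times> {\<beta>L<..<\<beta>s}" and V: "V differentiable (at (X z, Y z))"
  shows "pd1 F z = pd1 X z *\<^sub>R pd1 V (X z, Y z) + pd1 Y z *\<^sub>R pd2 V (X z, Y z)"
    and "pd2 F z = pd2 X z *\<^sub>R pd1 V (X z, Y z) + pd2 Y z *\<^sub>R pd2 V (X z, Y z)"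
proof -
  obtain a b where ab: "z = (a, b)" by (cases z)
  have "z \<in> {- \<alpha>0..0} \<times> {\<beta>L..\<beta>s}" using z by auto
  note D = fan_differentiable[OF this, unfolded ab]
  have "((\<lambda>s. (X (s, b), Y (s, b))) has_vector_derivative (pd1 X z, pd1 Y z)) (at a)"
    using has_derivative_Pair[OF pd_has_vector_derivative(1)[OF D(1), unfolded has_vector_derivative_def]
        pd_has_vector_derivative(1)[OF D(4), unfolded has_vector_derivative_def]]
    by (simp add: has_vector_derivative_def ab)
  from pd_along_curve[OF _ this, of V] V
  have "((\<lambda>s. V (X (s, b), Y (s, b))) has_vector_derivative
      pd1 X z *\<^sub>R pd1 V (X z, Y z) + pd1 Y z *\<^sub>R pd2 V (X z, Y z)) (at a)"
    by (simp add: ab)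
  then have "((\<lambda>s. F (s, b)) has_vector_derivative
      pd1 X z *\<^sub>R pd1 V (X z, Y z) + pd1 Y z *\<^sub>R pd2 V (X z, Y z)) (at a)"
    by (rule has_vector_derivative_transform_within_open[where S = "{- \<alpha>0<..<0}"])
       (use z ab represents in auto)
  then show "pd1 F z = pd1 X z *\<^sub>R pd1 V (X z, Y z) + pd1 Y z *\<^sub>R pd2 V (X z, Y z)"
    unfolding pd1_def[of F] ab fst_conv snd_conv by (rule vector_derivative_at)
  have "((\<lambda>s. (X (a, s), Y (a, s))) has_vector_derivative (pd2 X z, pd2 Y z)) (at b)"
    using has_derivative_Pair[OF pd_has_vector_derivative(2)[OF D(1), unfolded has_vector_derivative_def]
        pd_has_vector_derivative(2)[OF D(4), unfolded has_vector_derivative_def]]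
    by (simp add: has_vector_derivative_def ab)
  from pd_along_curve[OF _ this, of V] V
  have "((\<lambda>s. V (X (a, s), Y (a, s))) has_vector_derivative
      pd2 X z *\<^sub>R pd1 V (X z, Y z) + pd2 Y z *\<^sub>R pd2 V (X z, Y z)) (at b)"
    by (simp add: ab)
  then have "((\<lambda>s. F (a, s)) has_vector_derivative
      pd2 X z *\<^sub>R pd1 V (X z, Y z) + pd2 Y z *\<^sub>R pd2 V (X z, Y z)) (at b)"
    by (rule has_vector_derivative_transform_within_open[where S = "{\<beta>L<..<\<beta>s}"])
       (use z ab represents in auto)
  then show "pd2 F z = pd2 X z *\<^sub>R pd1 V (X z, Y z) + pd2 Y z *\<^sub>R pd2 V (X z, Y z)"
    unfolding pd2_def[of F] ab fst_conv snd_conv by (rule vector_derivative_at)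
qed

text \<open>Write \<open>\<Sigma>\<close> for the entropy in characteristic coordinates. It is transported with speed \<open>u1\<close>, and both
characteristic speeds differ from \<open>u1\<close> by \<open>c\<close>, with opposite signs; so \<open>\<Sigma>\<^sub>\<alpha> = - c t\<^sub>\<alpha> S\<^sub>x\<close> and
\<open>\<Sigma>\<^sub>\<beta> = c t\<^sub>\<beta> S\<^sub>x\<close>, whence \<open>\<Sigma>\<^sub>\<alpha> t\<^sub>\<beta> + \<Sigma>\<^sub>\<beta> t\<^sub>\<alpha> = 0\<close>. At the vertex \<open>\<Sigma>\<^sub>\<beta> = t\<^sub>\<beta> = 0\<close>, so differentiating this
relation in \<open>\<alpha>\<close> leaves \<open>\<Sigma>\<^sub>\<alpha> t\<^sub>\<alpha>\<^sub>\<beta> + \<Sigma>\<^sub>\<alpha>\<^sub>\<beta> t\<^sub>\<alpha> = 0\<close>, which says that \<open>\<Sigma>\<^sub>\<alpha> t\<^sub>\<alpha>\<close> is constant in \<open>\<beta>\<close>.\<close>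

lemma entropy_times_time_scale:
  assumes ent: "entropy S S'" and inv: "S \<in> {psi1, S1, psi2, psi3, S2}"
    and sol: "smooth_solution W V (wave_region T \<eta> \<gamma>0)" and opn: "open (wave_region T \<eta> \<gamma>0)"
  shows "S' (F (0, \<beta>s)) (pd1 F (0, \<beta>s)) * pd1 Y (0, \<beta>s)
       = S' (F (0, \<beta>L)) (pd1 F (0, \<beta>L)) * pd1 Y (0, \<beta>L)"
proof -
  interpret entropy S S' by (rule ent)
  obtain U where U: "open U" "{- \<alpha>0..0} \<times> {\<beta>L..\<beta>s} \<subseteq> U"
    and adm: "\<And>z. z \<in> U \<Longrightarrow> admissible (F z)"
    and dF: "\<And>z. z \<in> U \<Longrightarrow> F differentiable (at z) \<and> pd1 F differentiable (at z) \<and> pd2 F differentiable (at z)"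
    by (rule smooth_neighbourhood) (rule that; assumption)
  define \<Sigma> where "\<Sigma> z = S (F z)" for z
  have \<Sigma>: "\<Sigma> differentiable (at z)" if "z \<in> U" for z
    unfolding \<Sigma>_def[abs_def]
    by (rule differentiable_compose[of S]) (use derivative[OF adm[OF that]] dF[OF that] in \<open>auto simp: differentiable_def\<close>)
  have pd: "pd1 \<Sigma> z = S' (F z) (pd1 F z)" "pd2 \<Sigma> z = S' (F z) (pd2 F z)" if "z \<in> U" for z
    unfolding \<Sigma>_def[abs_def] using pd_compose[where S = S and V = F and z = z, OF _ derivative[OF adm[OF that]]] dF[OF that] by auto
  have dS: "(\<lambda>z. S' (F z) (G z)) differentiable (at z)"
    if "z \<in> U" "G differentiable (at z)" for z G
    using differentiable_compose[of "\<lambda>w. S' (fst w) (snd w)" "\<lambda>z. (F z, G z)" z UNIV]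
      derivative_smooth[OF adm[OF that(1)], of "G z"] dF[OF that(1)] that(2)
    by (auto intro: differentiable_Pair)
  have d\<Sigma>: "pd1 \<Sigma> differentiable (at z)" "pd2 \<Sigma> differentiable (at z)" if "z \<in> U" for z
    by (rule differentiable_transform_open[OF dS[of z "pd1 F"] U(1) that]; use that dF pd in simp)
       (rule differentiable_transform_open[OF dS[of z "pd2 F"] U(1) that]; use that dF pd in simp)
  have K: "(0, \<beta>) \<in> {- \<alpha>0..0} \<times> {\<beta>L..\<beta>s}" if "\<beta> \<in> {\<beta>L..\<beta>s}" for \<beta>
    using that ranges by auto
  have relation: "pd1 \<Sigma> z * pd2 Y z + pd2 \<Sigma> z * pd1 Y z = 0" if z: "z \<in> {- \<alpha>0<..<0} \<times> {\<beta>L<..<\<beta>s}" for z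
  proof -
    have zK: "z \<in> {- \<alpha>0..0} \<times> {\<beta>L..\<beta>s}" "z \<in> {- \<alpha>0..<0} \<times> {\<beta>L<..<\<beta>s}"
      "z \<in> {- \<alpha>0..<0} \<times> {\<beta>L..\<beta>s}" using z by auto
    let ?w = "(X z, Y z)"
    have w: "?w \<in> wave_region T \<eta> \<gamma>0" using interior[OF zK(2)] .
    then have V: "V differentiable (at ?w)" "ten_moment_at W V ?w"
      using sol by (simp_all add: smooth_solution_def C1_on_def differentiable_on_eq_differentiable_at[OF opn])
    have F: "F z = V ?w" using represents[OF zK(3)] .
    have a: "admissible (F z)" using admissible zK(1) by blast
    define \<sigma> where "\<sigma> = S' (F z) (pd1 V ?w)"
    have t: "S' (F z) (pd2 V ?w) = - u1 (F z) * \<sigma>"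
      unfolding \<sigma>_def by (rule transported[OF a]) (use ten_moment_jet_at[OF V] F in auto)
    have zU: "z \<in> U" using zK(1) U(2) by blast
    have "pd1 \<Sigma> z = pd1 X z * \<sigma> + pd1 Y z * (- u1 (F z) * \<sigma>)"
      "pd2 \<Sigma> z = pd2 X z * \<sigma> + pd2 Y z * (- u1 (F z) * \<sigma>)"
      unfolding pd[OF zU] pd_F_interior[OF z V(1)] linear_add[OF linear[OF a]] linear_scale[OF linear[OF a]]
      by (simp_all add: t flip: \<sigma>_def)
    then have "pd1 \<Sigma> z = - sound (F z) * pd1 Y z * \<sigma>" "pd2 \<Sigma> z = sound (F z) * pd2 Y z * \<sigma>"
      using characteristic_minus[OF zK(1)] characteristic_plus[OF zK(1)] by (simp_all add: algebra_simps)
    then show ?thesis by (simp add: algebra_simps)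
  qed
  define g where "g \<beta> = pd1 \<Sigma> (0, \<beta>) * pd1 Y (0, \<beta>)" for \<beta>
  have "g \<beta>s = g \<beta>L"
  proof (rule constant_along_vertex)
    have "isCont (\<lambda>s. pd1 Y (0, s)) \<beta>" "isCont (\<lambda>s. pd1 \<Sigma> (0, s)) \<beta>" if "\<beta> \<in> {\<beta>L..\<beta>s}" for \<beta>
      using pd_has_real_derivative(2)[OF fan_differentiable(5)[OF K[OF that]]] pd_has_real_derivative(2)[OF d\<Sigma>(1)[of "(0, \<beta>)"]]
        K[OF that] U(2) DERIV_isCont by blast+
    then show "continuous_on {\<beta>L..\<beta>s} g"
      unfolding g_def[abs_def]
      by (intro continuous_intros continuous_at_imp_continuous_on) auto
  next
    fix \<beta> assume b: "\<beta>L < \<beta>" "\<beta> < \<beta>s"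
    then have b': "\<beta> \<in> {\<beta>L..\<beta>s}" by auto
    have zU: "(0, \<beta>) \<in> U" using K[OF b'] U(2) by blast
    note D = fan_differentiable[OF K[OF b']]
    have "((\<lambda>s. \<Sigma> (0, s)) has_real_derivative 0) (at \<beta>)"
      by (rule has_field_derivative_transform_within_open[OF DERIV_const[of "S VL"], where S = "{\<beta>L<..<\<beta>s}"])
         (use b invariants_at_origin[OF inv] in \<open>auto simp: \<Sigma>_def\<close>)
    then have \<Sigma>0: "pd2 \<Sigma> (0, \<beta>) = 0"
      using DERIV_unique pd_has_real_derivative(2)[OF \<Sigma>[OF zU]] by blast
    have "((\<lambda>s. pd1 \<Sigma> (s, \<beta>) * pd2 Y (s, \<beta>) + pd2 \<Sigma> (s, \<beta>) * pd1 Y (s, \<beta>)) has_real_derivative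
       (pd1 (pd1 \<Sigma>) (0, \<beta>) * pd2 Y (0, \<beta>) + pd1 (pd2 Y) (0, \<beta>) * pd1 \<Sigma> (0, \<beta>))
       + (pd1 (pd2 \<Sigma>) (0, \<beta>) * pd1 Y (0, \<beta>) + pd1 (pd1 Y) (0, \<beta>) * pd2 \<Sigma> (0, \<beta>))) (at 0)"
      by (intro DERIV_add DERIV_mult pd_has_real_derivative(1) D d\<Sigma> zU)
    moreover have "pd1 \<Sigma> (s, \<beta>) * pd2 Y (s, \<beta>) + pd2 \<Sigma> (s, \<beta>) * pd1 Y (s, \<beta>) = 0"
      if "- \<alpha>0 < s" "s \<le> 0" for s
      using relation[of "(s, \<beta>)"] that b \<Sigma>0 Y_beta_at_vertex[OF b] by (cases "s = 0") auto
    ultimately have "(pd1 (pd1 \<Sigma>) (0, \<beta>) * pd2 Y (0, \<beta>) + pd1 (pd2 Y) (0, \<beta>) * pd1 \<Sigma> (0, \<beta>))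
       + (pd1 (pd2 \<Sigma>) (0, \<beta>) * pd1 Y (0, \<beta>) + pd1 (pd1 Y) (0, \<beta>) * pd2 \<Sigma> (0, \<beta>)) = 0"
      using derivative_zero_if_zero_left ranges(1) by blast
    then have "pd2 (pd1 Y) (0, \<beta>) * pd1 \<Sigma> (0, \<beta>) + pd2 (pd1 \<Sigma>) (0, \<beta>) * pd1 Y (0, \<beta>) = 0"
      using Y_beta_at_vertex[OF b] \<Sigma>0 mixed_pd_fan(1)[OF K[OF b']]
        mixed_pd_symmetric[OF U(1) zU \<Sigma> d\<Sigma>[OF zU]] by simp
    moreover have "(g has_real_derivative
        pd2 (pd1 \<Sigma>) (0, \<beta>) * pd1 Y (0, \<beta>) + pd2 (pd1 Y) (0, \<beta>) * pd1 \<Sigma> (0, \<beta>)) (at \<beta>)"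
      unfolding g_def[abs_def] by (intro DERIV_mult pd_has_real_derivative(2) D d\<Sigma> zU)
    ultimately show "(g has_real_derivative 0) (at \<beta>)" by (simp add: algebra_simps)
  qed
  then show ?thesis
    using pd(1)[OF subsetD[OF U(2) K[of \<beta>s]]] pd(1)[OF subsetD[OF U(2) K[of \<beta>L]]] ranges(2)
    by (simp add: g_def)
qed

text \<open>On the head or the tail, a curve \<open>\<beta> = const\<close>, the solution in the fan is the trace of the solution in the
region on the other side, so its \<open>\<alpha>\<close>-derivative at the vertex can be computed from the limit gradient there.\<close>

lemma edge_derivative:
  assumes b: "\<beta> \<in> {\<beta>L..\<beta>s}"
    and diff: "\<And>z. z \<in> R \<Longrightarrow> V differentiable (at z)" and R0: "0 \<notin> R"
    and lim: "(V \<longlongrightarrow> A) (at 0 within R)" "(pd1 V \<longlongrightarrow> B) (at 0 within R)" "(pd2 V \<longlongrightarrow> C) (at 0 within R)"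
    and push: "\<And>s1 s2. - \<alpha>0 < s1 \<Longrightarrow> s1 \<le> s2 \<Longrightarrow> s2 < 0 \<Longrightarrow>
      \<exists>h0>0. \<forall>s h. s1 \<le> s \<and> s \<le> s2 \<and> 0 < h \<and> h < h0 \<longrightarrow> (X (s, \<beta>), Y (s, \<beta>)) + h *\<^sub>R e \<in> R"
    and cont: "\<And>s. - \<alpha>0 < s \<Longrightarrow> s < 0 \<Longrightarrow> isCont V (X (s, \<beta>), Y (s, \<beta>))"
  shows "F (0, \<beta>) = A" "pd1 F (0, \<beta>) = pd1 Y (0, \<beta>) *\<^sub>R (\<beta> *\<^sub>R B + C)"
proof -
  define p where "p s = (X (s, \<beta>), Y (s, \<beta>))" for s
  define p' where "p' s = (pd1 X (s, \<beta>), pd1 Y (s, \<beta>))" for s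
  have K: "(s, \<beta>) \<in> {- \<alpha>0..0} \<times> {\<beta>L..\<beta>s}" if "- \<alpha>0 < s" "s \<le> 0" for s
    using that b by auto
  note D0 = fan_differentiable[OF K[of 0]]
  have a0: "- \<alpha>0 < 0" using ranges by simp
  have p: "(p has_vector_derivative p' s) (at s)" if "- \<alpha>0 < s" "s \<le> 0" for s
    using has_derivative_Pair[OF pd_has_vector_derivative(1)[OF fan_differentiable(1)[OF K[OF that]], unfolded has_vector_derivative_def]
        pd_has_vector_derivative(1)[OF fan_differentiable(4)[OF K[OF that]], unfolded has_vector_derivative_def]]
    by (simp add: has_vector_derivative_def p_def[abs_def] p'_def)
  have "isCont p' 0"
    unfolding p'_def[abs_def]
    using D0 a0 by (intro continuous_Pair DERIV_isCont[OF pd_has_real_derivative(1)]) auto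
  then have p': "(p' \<longlongrightarrow> p' 0) (at_left 0)"
    unfolding continuous_at by (metis filterlim_at_split)
  have G: "((\<lambda>h. V (p s + h *\<^sub>R e)) \<longlongrightarrow> F (s, \<beta>)) (at_right 0)" if s: "- \<alpha>0 < s" "s < 0" for s
  proof -
    have "((\<lambda>h. p s + h *\<^sub>R e) \<longlongrightarrow> p s + 0 *\<^sub>R e) (at_right 0)"
      by (intro tendsto_intros)
    then have "((\<lambda>h. V (p s + h *\<^sub>R e)) \<longlongrightarrow> V (p s)) (at_right 0)"
      using cont[OF s] by (intro isCont_tendsto_compose[of _ V]) (auto simp: p_def)
    then show ?thesis using represents[of "(s, \<beta>)"] s b by (simp add: p_def)
  qed
  note E = one_sided_derivative_on_boundary_curve[where p = p and p' = p' and q = "p' 0" and a = \<alpha>0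
      and G = "\<lambda>s. F (s, \<beta>)" and e = e, OF diff R0 lim ranges(1) _ p[OF a0 order_refl] p _ push[folded p_def] G]
  have F: "((\<lambda>s. F (s, \<beta>)) has_vector_derivative pd1 F (0, \<beta>)) (at 0)"
    by (rule pd_has_vector_derivative(1)) (use D0 a0 in auto)
  have p0: "p 0 = 0" using origin[OF b] by (simp add: p_def zero_prod_def)
  have "((\<lambda>s. F (s, \<beta>)) \<longlongrightarrow> F (0, \<beta>)) (at_left 0)"
    using has_vector_derivative_continuous[OF F] unfolding continuous_at by (metis filterlim_at_split)
  then show A: "F (0, \<beta>) = A"
    using E(1)[OF _ p0 _ _ p'] tendsto_unique[OF trivial_limit_at_left_real] by auto
  have "((\<lambda>s. (1 / s) *\<^sub>R (F (s, \<beta>) - F (0, \<beta>))) \<longlongrightarrow> pd1 F (0, \<beta>)) (at_left 0)"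
    using vector_derivative_quotient[OF F] by (rule tendsto_mono[OF at_le, rotated]) simp
  moreover have "fst (p' 0) *\<^sub>R B + snd (p' 0) *\<^sub>R C = pd1 Y (0, \<beta>) *\<^sub>R (\<beta> *\<^sub>R B + C)"
    using slope[OF b] by (simp add: p'_def algebra_simps)
  ultimately show "pd1 F (0, \<beta>) = pd1 Y (0, \<beta>) *\<^sub>R (\<beta> *\<^sub>R B + C)"
    using E(2)[OF _ p0 _ _ p'] tendsto_unique[OF trivial_limit_at_left_real] A by auto
qed

end

section \<open>Limits at the origin outside the fan\<close>

lemma open_wave_region:
  assumes "continuous_on {0..<T} f" "continuous_on {0..<T} g"
  shows "open (wave_region T f g)"
proof -
  have c: "continuous_on {z. 0 < snd z \<and> snd z < T} (\<lambda>z::real \<times> real. k (snd z))"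
    if "continuous_on {0..<T} k" for k :: "real \<Rightarrow> real"
    by (rule continuous_on_compose2[OF that]) (auto intro!: continuous_intros)
  have o: "open {z::real \<times> real. 0 < snd z \<and> snd z < T}"
    by (intro open_Collect_conj open_Collect_less continuous_intros)
  have "open ({z. 0 < snd z \<and> snd z < T} \<inter> (\<lambda>z. (fst z - f (snd z), g (snd z) - fst z)) -` ({0<..} \<times> {0<..}))"
    by (intro continuous_open_preimage continuous_on_Pair continuous_on_diff continuous_intros c assms o open_Times)
  also have "\<dots> = wave_region T f g"
    by (auto simp: wave_region_def)
  finally show ?thesis .
qed

lemma continuous_pos_lower_bound:
  fixes f :: "real \<Rightarrow> real"
  assumes "continuous_on {a..b} f" "\<And>s. s \<in> {a..b} \<Longrightarrow> f s > 0"
  obtains m where "m > 0" "\<And>s. s \<in> {a..b} \<Longrightarrow> m \<le> f s"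
proof (cases "a \<le> b")
  case True
  then obtain x where "x \<in> {a..b}" "\<forall>y\<in>{a..b}. f x \<le> f y"
    using continuous_attains_inf[OF compact_Icc _ assms(1)] by auto
  then show ?thesis using assms(2) by (intro that[of "f x"]) auto
qed (use that[of 1] in auto)

lemma at_origin_nontrivial:
  assumes "(x \<longlongrightarrow> 0) (at_right 0)" "T > 0" "\<And>t. 0 < t \<Longrightarrow> t < T \<Longrightarrow> (x t, t) \<in> R"
  shows "at (0::real \<times> real) within R \<noteq> bot"
proof
  assume "at (0::real \<times> real) within R = bot"
  then have "eventually (\<lambda>_. False) (at (0::real \<times> real) within R)" by simp
  then obtain d where d: "d > 0" "\<And>z. z \<in> R \<Longrightarrow> z \<noteq> 0 \<Longrightarrow> \<not> dist z 0 < d"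
    unfolding eventually_at by blast
  have "((\<lambda>t. (x t, t)) \<longlongrightarrow> (0, 0)) (at_right 0)"
    by (intro tendsto_intros assms(1))
  from tendstoD[OF this d(1)]
  have "\<forall>\<^sub>F t in at_right 0. dist (x t, t) 0 < d" by (simp add: zero_prod_def)
  moreover have "\<forall>\<^sub>F t in at_right 0. 0 < t \<and> t < T"
    using assms(2) eventually_at_right_field by blast
  ultimately have "\<forall>\<^sub>F t in at_right (0::real). False"
    by eventually_elim (use d(2)[OF assms(3)] in \<open>auto simp: zero_prod_def\<close>)
  then show False using trivial_limit_at_right_real by simp
qed

context grp_solution
begin

abbreviation left_region :: "(real \<times> real) set" where
  "left_region \<equiv> wave_region T (\<lambda>_. - r) \<eta>"

abbreviation fan_region :: "(real \<times> real) set" where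
  "fan_region \<equiv> wave_region T \<eta> (\<gamma> 0)"

abbreviation starL_region :: "(real \<times> real) set" where
  "starL_region \<equiv> wave_region T (\<gamma> 0) (\<gamma> 1)"

lemma open_regions: "open left_region" "open fan_region" "open starL_region"
   "open (wave_region T (\<lambda>_. - r) (\<gamma> 1))"
  using waves by (auto intro!: open_wave_region curves_continuous)

lemma curve_order:
  assumes "0 < t" "t < T"
  shows "- r < \<eta> t" "\<eta> t < \<gamma> 0 t" "\<gamma> 0 t < \<gamma> 1 t"
  using curves_ordered(1)[OF assms] curves_ordered(2)[OF assms, of 0] waves by auto

lemma origin_notin: "0 \<notin> wave_region T f g"
  by (auto simp: wave_region_def zero_prod_def)

lemma curve_tendsto_0:
  assumes "continuous_on {0..<T} f" "f 0 = 0"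
  shows "(f \<longlongrightarrow> 0) (at_right 0)"
proof -
  have "(f \<longlongrightarrow> f 0) (at 0 within {0..<T})"
    using assms(1) domain(2) by (simp add: continuous_on_def del: atLeastLessThan_iff) simp
  moreover have "at 0 within {0..<T} = at_right 0"
    using domain(2) by (intro at_within_nhd[of 0 "{- 1<..<T}"]) auto
  ultimately show ?thesis
    using assms(2) by simp
qed

lemma left_nontrivial: "at 0 within left_region \<noteq> bot"
proof (rule at_origin_nontrivial[OF _ domain(2)])
  show "((\<lambda>t. \<eta> t - min t ((\<eta> t + r) / 2)) \<longlongrightarrow> 0) (at_right 0)"
  proof -
    have e: "(\<eta> \<longlongrightarrow> 0) (at_right 0)"
      by (rule curve_tendsto_0[OF curves_continuous(1) curves_origin(1)])
    have "((\<lambda>t. \<eta> t - min t ((\<eta> t + r) / 2)) \<longlongrightarrow> 0 - min 0 ((0 + r) / 2)) (at_right 0)"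
      by (intro tendsto_intros e) auto
    then show ?thesis using domain by simp
  qed
next
  fix t assume t: "0 < t" "t < T"
  then show "(\<eta> t - min t ((\<eta> t + r) / 2), t) \<in> left_region"
    using curve_order[OF t] by (auto simp: wave_region_def min_def field_simps)
qed

lemma starL_nontrivial: "at 0 within starL_region \<noteq> bot"
proof (rule at_origin_nontrivial[OF _ domain(2)])
  have "(\<gamma> i \<longlongrightarrow> 0) (at_right 0)" if "i \<le> n" for i
    using curve_tendsto_0 curves_continuous(2) curves_origin(2) that by blast
  from this[of 0] this[of 1] have "((\<lambda>t. (\<gamma> 0 t + \<gamma> 1 t) / 2) \<longlongrightarrow> (0 + 0) / 2) (at_right 0)"
    using waves by (intro tendsto_intros) auto
  then show "((\<lambda>t. (\<gamma> 0 t + \<gamma> 1 t) / 2) \<longlongrightarrow> 0) (at_right 0)" by simp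
next
  fix t assume t: "0 < t" "t < T"
  then show "((\<gamma> 0 t + \<gamma> 1 t) / 2, t) \<in> starL_region"
    using curve_order[OF t] by (auto simp: wave_region_def)
qed

lemma smooth_region:
  assumes "smooth_solution W V R" "open R" "z \<in> R"
  shows "V differentiable (at z)" "ten_moment_jet (deriv W (fst z)) (V z) (pd1 V z) (pd2 V z)"
    and "admissible (V z)"
proof -
  show V: "V differentiable (at z)"
    using assms by (simp add: smooth_solution_def C1_on_def differentiable_on_eq_differentiable_at)
  show "ten_moment_jet (deriv W (fst z)) (V z) (pd1 V z) (pd2 V z)" "admissible (V z)"
    using assms ten_moment_jet_at[OF V] by (auto simp: smooth_solution_def)
qed

lemma force_tendsto: "((\<lambda>z. deriv W (fst z)) \<longlongrightarrow> deriv W 0) (at 0 within (R :: (real \<times> real) set))"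
proof -
  obtain D where D: "\<And>x. (W has_vector_derivative D x) (at x)" "continuous_on UNIV D"
    using potential unfolding C1_differentiable_on_def by auto
  then have "deriv W = D"
    by (auto simp: fun_eq_iff has_real_derivative_iff_has_vector_derivative intro!: DERIV_imp_deriv)
  then have "isCont (deriv W) (fst (0::real \<times> real))"
    using D(2) by (simp add: continuous_on_eq_continuous_at)
  moreover have "(fst \<longlongrightarrow> fst (0::real \<times> real)) (at 0 within R)"
    by (rule tendsto_fst[OF tendsto_ident_at])
  ultimately show ?thesis
    using isCont_tendsto_compose by fastforce
qed

lemma limit_jet:
  assumes R: "smooth_solution W V R" "open R" "at 0 within R \<noteq> bot"
    and lim: "(V \<longlongrightarrow> A) (at 0 within R)" "(pd1 V \<longlongrightarrow> B) (at 0 within R)" "(pd2 V \<longlongrightarrow> C) (at 0 within R)"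
    and A: "admissible A"
  shows "ten_moment_jet (deriv W 0) A B C"
proof (rule ten_moment_jet_limit[OF R(3) _ force_tendsto lim])
  show "\<forall>\<^sub>F z in at 0 within R. ten_moment_jet (deriv W (fst z)) (V z) (pd1 V z) (pd2 V z)"
    unfolding eventually_at_filter using smooth_region(2)[OF R(1,2)] by (auto intro: always_eventually)
  show "rho A \<noteq> 0" using A by (simp add: admissible_def)
qed

text \<open>The state and slope of the initial data are recovered as the limits from the left region by taking the
initial line as boundary curve, with shifts in the direction of time.\<close>

lemma left_limits:
  assumes A: "(V \<longlongrightarrow> A) (at 0 within left_region)" and B: "(pd1 V \<longlongrightarrow> B) (at 0 within left_region)"
  shows "A = VL" "B = VL'"
proof -
  obtain C where C: "(pd2 V \<longlongrightarrow> C) (at 0 within left_region)"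
    using limits(1) by (auto simp: has_limits_at_origin_def zero_prod_def)
  define G where "G s = VL + s *\<^sub>R VL'" for s
  define p where "p s = (s, 0::real)" for s :: real
  have e: "(\<eta> \<longlongrightarrow> 0) (at_right 0)"
    by (rule curve_tendsto_0[OF curves_continuous(1) curves_origin(1)])
  have push: "\<exists>h0>0. \<forall>s h. s1 \<le> s \<and> s \<le> s2 \<and> 0 < h \<and> h < h0 \<longrightarrow> p s + h *\<^sub>R (0, 1) \<in> left_region"
    if s: "- r < s1" "s1 \<le> s2" "s2 < 0" for s1 s2
  proof -
    have "\<forall>\<^sub>F h in at_right 0. s2 < \<eta> h"
      using order_tendstoD(1)[OF e s(3)] .
    then obtain h1 where h1: "h1 > 0" "\<And>h. 0 < h \<Longrightarrow> h < h1 \<Longrightarrow> s2 < \<eta> h"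
      unfolding eventually_at_right_field by blast
    then show ?thesis
      using s domain by (intro exI[of _ "min h1 T"]) (force simp: p_def wave_region_def)
  qed
  have trace: "((\<lambda>h. V (p s + h *\<^sub>R (0, 1))) \<longlongrightarrow> G s) (at_right 0)" if s: "- r < s" "s < 0" for s
  proof -
    let ?S = "left_region \<union> {- r<..<0} \<times> {0}"
    have "(V \<longlongrightarrow> V (s, 0)) (at (s, 0) within ?S)"
      using initial_left(2) s unfolding continuous_on_def by auto
    moreover have "filterlim (\<lambda>h. p s + h *\<^sub>R (0, 1)) (at (s, 0) within ?S) (at_right 0)"
      unfolding filterlim_at
    proof
      obtain h0 where h0: "h0 > 0" "\<And>h. 0 < h \<Longrightarrow> h < h0 \<Longrightarrow> p s + h *\<^sub>R (0, 1) \<in> left_region"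
        using push[of s s] s by auto
      then show "\<forall>\<^sub>F h in at_right 0. p s + h *\<^sub>R (0, 1) \<in> ?S \<and> p s + h *\<^sub>R (0, 1) \<noteq> (s, 0)"
        unfolding eventually_at_right_field by (intro exI[of _ h0]) (auto simp: p_def)
      have "((\<lambda>h. p s + h *\<^sub>R (0, 1)) \<longlongrightarrow> p s + 0 *\<^sub>R (0, 1)) (at_right 0)"
        by (intro tendsto_intros)
      then show "((\<lambda>h. p s + h *\<^sub>R (0, 1)) \<longlongrightarrow> (s, 0)) (at_right 0)"
        by (simp add: p_def)
    qed
    ultimately have "((\<lambda>h. V (p s + h *\<^sub>R (0, 1))) \<longlongrightarrow> V (s, 0)) (at_right 0)"
      by (rule filterlim_compose)
    then show ?thesis using initial_left(1)[OF s] by (simp add: G_def)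
  qed
  have p: "(p has_vector_derivative (1, 0)) (at s)" for s
    unfolding p_def[abs_def] has_vector_derivative_def
    by (auto intro!: derivative_eq_intros)
  have p0: "p 0 = 0" by (simp add: p_def zero_prod_def)
  have p'q: "((\<lambda>_. (1, 0)) \<longlongrightarrow> (1, 0::real)) (at_left (0::real))"
    by (rule tendsto_const)
  have diff: "V differentiable (at z)" if "z \<in> left_region" for z
    by (rule smooth_region(1)[OF smooth(1) open_regions(1) that])
  have E1: "(G \<longlongrightarrow> A) (at_left 0)"
    by (rule one_sided_derivative_on_boundary_curve(1)[OF diff origin_notin A B C domain(1) p0 p p p'q push trace])
  have E2: "((\<lambda>s. (1 / s) *\<^sub>R (G s - A)) \<longlongrightarrow> fst (1, 0::real) *\<^sub>R B + snd (1::real, 0) *\<^sub>R C) (at_left 0)"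
    by (rule one_sided_derivative_on_boundary_curve(2)[OF diff origin_notin A B C domain(1) p0 p p p'q push trace])
  have "(G \<longlongrightarrow> VL + 0 *\<^sub>R VL') (at_left 0)"
    unfolding G_def by (intro tendsto_intros)
  then show AL: "A = VL"
    using E1 tendsto_unique[OF trivial_limit_at_left_real] by fastforce
  have "((\<lambda>s. (1 / s) *\<^sub>R (G s - A)) \<longlongrightarrow> VL') (at_left 0)"
    by (rule Lim_transform_eventually[OF tendsto_const])
       (auto simp: eventually_at_filter G_def AL)
  moreover have "((\<lambda>s. (1 / s) *\<^sub>R (G s - A)) \<longlongrightarrow> B) (at_left 0)"
    using E2 by simp
  ultimately show "B = VL'"
    using tendsto_unique[OF trivial_limit_at_left_real] by blast
qed

end

section \<open>The passage across the fan\<close>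

locale grp_with_fan =
  grp_solution W V VL VL' VR VR' r T n \<eta> \<gamma> \<zeta> +
  fan: rarefaction_fan V VL "lam1 VL" "lam1 Vs" r T \<eta> "\<gamma> 0" "\<gamma> 1" \<alpha>0 X Y F
  for W V VL VL' VR VR' r T n \<eta> \<gamma> \<zeta> Vs \<alpha>0 X Y F +
  assumes Vs: "Vs = lim0 (wave_region T (\<gamma> 0) (\<gamma> 1)) V"
begin

lemma lim0_starL: "(f \<longlongrightarrow> l) (at 0 within starL_region) \<Longrightarrow> lim0 starL_region f = l"
  using tendsto_Lim[OF starL_nontrivial] by (simp add: lim0_def zero_prod_def)

lemma starL_limits:
  obtains B C where "(V \<longlongrightarrow> Vs) (at 0 within starL_region)"
    "(pd1 V \<longlongrightarrow> B) (at 0 within starL_region)" "(pd2 V \<longlongrightarrow> C) (at 0 within starL_region)"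
    "ten_moment_jet (deriv W 0) Vs B C"
proof -
  obtain A B C where lim: "(V \<longlongrightarrow> A) (at 0 within starL_region)"
    "(pd1 V \<longlongrightarrow> B) (at 0 within starL_region)" "(pd2 V \<longlongrightarrow> C) (at 0 within starL_region)"
    using limits(2) by (auto simp: has_limits_at_origin_def zero_prod_def)
  have A: "A = Vs" using lim0_starL[OF lim(1)] Vs by simp
  have "smooth_solution W V starL_region" using smooth(3)[of 0] waves by simp
  from limit_jet[OF this open_regions(3) starL_nontrivial lim] limit_state A Vs
  have "ten_moment_jet (deriv W 0) A B C" by simp
  then show thesis using lim A by (intro that[of B C]) auto
qed

lemma admissible_Vs: "admissible Vs"
  using limit_state Vs by simp

lemma fan_edge:
  assumes "\<beta> \<in> {lam1 VL..lam1 Vs}" "- \<alpha>0 < s" "s < 0"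
  shows "isCont (\<lambda>s. X (s, \<beta>)) s" "isCont (\<lambda>s. Y (s, \<beta>)) s" "0 < Y (s, \<beta>)" "Y (s, \<beta>) < T"
proof -
  have z: "(s, \<beta>) \<in> {- \<alpha>0..0} \<times> {lam1 VL..lam1 Vs}" using assms by auto
  show "isCont (\<lambda>s. X (s, \<beta>)) s" "isCont (\<lambda>s. Y (s, \<beta>)) s"
    using pd_has_real_derivative(1)[OF fan.fan_differentiable(1)[OF z]] pd_has_real_derivative(1)[OF fan.fan_differentiable(4)[OF z]]
    by (auto intro: DERIV_isCont)
  show "0 < Y (s, \<beta>)" "Y (s, \<beta>) < T"
    using fan.positive_time[of "(s, \<beta>)"] assms by auto
qed

lemma isCont_V:
  assumes "0 < t" "t < T" "- r < x" "x < \<gamma> 1 t"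
  shows "isCont V (x, t)"
  using assms fan.continuous_across_head_and_tail open_regions(4)
  by (auto simp: continuous_on_eq_continuous_at wave_region_def)

lemma head_derivative:
  obtains C where "ten_moment_jet (deriv W 0) VL VL' C" "F (0, lam1 VL) = VL"
    "pd1 F (0, lam1 VL) = pd1 Y (0, lam1 VL) *\<^sub>R (lam1 VL *\<^sub>R VL' + C)"
proof -
  obtain A B C where lim': "(V \<longlongrightarrow> A) (at 0 within left_region)"
    "(pd1 V \<longlongrightarrow> B) (at 0 within left_region)" "(pd2 V \<longlongrightarrow> C) (at 0 within left_region)"
    using limits(1) by (auto simp: has_limits_at_origin_def zero_prod_def)
  note lim = lim'[unfolded left_limits[OF lim'(1,2)]]
  have b: "lam1 VL \<in> {lam1 VL..lam1 Vs}" using fan.ranges(2) by simp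
  have X: "X (s, lam1 VL) = \<eta> (Y (s, lam1 VL))" if "- \<alpha>0 < s" "s < 0" for s
    using fan.head that by simp
  \<comment> \<open>A shift to the left enters the left region; it must not cross its far side \<open>x = - r\<close>.\<close>
  have push: "\<exists>h0>0. \<forall>s h. s1 \<le> s \<and> s \<le> s2 \<and> 0 < h \<and> h < h0 \<longrightarrow>
      (X (s, lam1 VL), Y (s, lam1 VL)) + h *\<^sub>R (- 1, 0) \<in> left_region"
    if s: "- \<alpha>0 < s1" "s1 \<le> s2" "s2 < 0" for s1 s2
  proof -
    have "continuous_on {s1..s2} (\<lambda>s. X (s, lam1 VL) + r)"
      using fan_edge(1)[OF b] s by (intro continuous_at_imp_continuous_on continuous_intros) auto
    moreover have "X (s, lam1 VL) + r > 0" if "s \<in> {s1..s2}" for s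
    proof -
      have s': "- \<alpha>0 < s" "s < 0" using that s by auto
      show ?thesis
        using X[OF s'] curve_order(1)[OF fan_edge(3,4)[OF b s']] by simp
    qed
    ultimately obtain m where m: "m > 0" "\<And>s. s \<in> {s1..s2} \<Longrightarrow> m \<le> X (s, lam1 VL) + r"
      using continuous_pos_lower_bound by blast
    have "(X (s, lam1 VL), Y (s, lam1 VL)) + h *\<^sub>R (- 1, 0) \<in> left_region"
      if "s1 \<le> s" "s \<le> s2" "0 < h" "h < m" for s h
    proof -
      have s': "- \<alpha>0 < s" "s < 0" using that s by auto
      show ?thesis
        using X[OF s'] fan_edge(3,4)[OF b s'] m(2)[of s] that by (simp add: wave_region_def)
    qed
    then show ?thesis using m(1) by blast
  qed
  have cont: "isCont V (X (s, lam1 VL), Y (s, lam1 VL))" if s: "- \<alpha>0 < s" "s < 0" for s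
    using fan_edge(3,4)[OF b s] curve_order[OF fan_edge(3,4)[OF b s]] X[OF s] by (intro isCont_V) auto
  have diff: "V differentiable (at z)" if "z \<in> left_region" for z
    by (rule smooth_region(1)[OF smooth(1) open_regions(1) that])
  show thesis
    using limit_jet[OF smooth(1) open_regions(1) left_nontrivial lim states(1)]
      fan.edge_derivative[OF b diff origin_notin lim push cont] by (intro that)
qed

lemma tail_derivative:
  assumes lim: "(V \<longlongrightarrow> Vs) (at 0 within starL_region)"
    "(pd1 V \<longlongrightarrow> B) (at 0 within starL_region)" "(pd2 V \<longlongrightarrow> C) (at 0 within starL_region)"
  shows "F (0, lam1 Vs) = Vs"
    "pd1 F (0, lam1 Vs) = pd1 Y (0, lam1 Vs) *\<^sub>R (lam1 Vs *\<^sub>R B + C)"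
proof -
  have b: "lam1 Vs \<in> {lam1 VL..lam1 Vs}" using fan.ranges(2) by simp
  have X: "X (s, lam1 Vs) = \<gamma> 0 (Y (s, lam1 Vs))" if "- \<alpha>0 < s" "s < 0" for s
    using fan.tail that by simp
  \<comment> \<open>A shift to the right enters region \<open>*L\<close>; it must not cross the shear wave.\<close>
  have push: "\<exists>h0>0. \<forall>s h. s1 \<le> s \<and> s \<le> s2 \<and> 0 < h \<and> h < h0 \<longrightarrow>
      (X (s, lam1 Vs), Y (s, lam1 Vs)) + h *\<^sub>R (1, 0) \<in> starL_region"
    if s: "- \<alpha>0 < s1" "s1 \<le> s2" "s2 < 0" for s1 s2
  proof -
    have "continuous_on {s1..s2} (\<lambda>s. Y (s, lam1 Vs))"
      using fan_edge(2)[OF b] s by (intro continuous_at_imp_continuous_on) auto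
    moreover have "Y (s, lam1 Vs) \<in> {0..<T}" if "s \<in> {s1..s2}" for s
      using fan_edge(3,4)[OF b, of s] that s by force
    moreover have "continuous_on {0..<T} (\<gamma> 1)" using curves_continuous(2) waves by simp
    ultimately have "continuous_on {s1..s2} (\<lambda>s. \<gamma> 1 (Y (s, lam1 Vs)))"
      using continuous_on_compose2[of "{0..<T}" "\<gamma> 1"] by blast
    moreover have "continuous_on {s1..s2} (\<lambda>s. X (s, lam1 Vs))"
      using fan_edge(1)[OF b] s by (intro continuous_at_imp_continuous_on) auto
    ultimately have "continuous_on {s1..s2} (\<lambda>s. \<gamma> 1 (Y (s, lam1 Vs)) - X (s, lam1 Vs))"
      by (intro continuous_on_diff)
    moreover have "\<gamma> 1 (Y (s, lam1 Vs)) - X (s, lam1 Vs) > 0" if "s \<in> {s1..s2}" for s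
    proof -
      have s': "- \<alpha>0 < s" "s < 0" using that s by auto
      show ?thesis
        using X[OF s'] curve_order(3)[OF fan_edge(3,4)[OF b s']] by simp
    qed
    ultimately obtain m where m: "m > 0" "\<And>s. s \<in> {s1..s2} \<Longrightarrow> m \<le> \<gamma> 1 (Y (s, lam1 Vs)) - X (s, lam1 Vs)"
      using continuous_pos_lower_bound[of s1 s2] by blast
    have "(X (s, lam1 Vs), Y (s, lam1 Vs)) + h *\<^sub>R (1, 0) \<in> starL_region"
      if "s1 \<le> s" "s \<le> s2" "0 < h" "h < m" for s h
    proof -
      have s': "- \<alpha>0 < s" "s < 0" using that s by auto
      show ?thesis
        using X[OF s'] fan_edge(3,4)[OF b s'] m(2)[of s] that by (simp add: wave_region_def)
    qed
    then show ?thesis using m(1) by blast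
  qed
  have cont: "isCont V (X (s, lam1 Vs), Y (s, lam1 Vs))" if s: "- \<alpha>0 < s" "s < 0" for s
    using fan_edge(3,4)[OF b s] curve_order[OF fan_edge(3,4)[OF b s]] X[OF s] by (intro isCont_V) auto
  have sol: "smooth_solution W V starL_region" using smooth(3)[of 0] waves by simp
  have diff: "V differentiable (at z)" if "z \<in> starL_region" for z
    by (rule smooth_region(1)[OF sol open_regions(3) that])
  show "F (0, lam1 Vs) = Vs" "pd1 F (0, lam1 Vs) = pd1 Y (0, lam1 Vs) *\<^sub>R (lam1 Vs *\<^sub>R B + C)"
    using fan.edge_derivative[OF b diff origin_notin lim push cont] by blast+
qed

text \<open>The quotient \<open>S\<^sub>x / c\<close> at the origin is the same on both sides of the fan. On a curve of speed \<open>u1 - c\<close> the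
transport equation gives \<open>\<Sigma>\<^sub>\<alpha> = - c t\<^sub>\<alpha> S\<^sub>x\<close>, with \<open>S\<^sub>x\<close> taken from the adjacent region; since \<open>\<Sigma>\<^sub>\<alpha> t\<^sub>\<alpha>\<close> and
\<open>c t\<^sub>\<alpha>\<close> do not change from head to tail, neither does \<open>S\<^sub>x t\<^sub>\<alpha>\<close>, nor therefore \<open>S\<^sub>x / c\<close>.\<close>

lemma entropy_derivative_across_fan:
  assumes ent: "entropy S S'" and inv: "S \<in> {psi1, S1, psi2, psi3, S2}"
    and lim: "(V \<longlongrightarrow> Vs) (at 0 within starL_region)"
    "(pd1 V \<longlongrightarrow> B) (at 0 within starL_region)" "(pd2 V \<longlongrightarrow> C) (at 0 within starL_region)"
    and jet: "ten_moment_jet (deriv W 0) Vs B C"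
  shows "S' Vs B = S' VL VL' / sound VL * sound Vs"
proof -
  interpret entropy S S' by (rule ent)
  \<comment> \<open>The \<open>\<alpha>\<close>-derivative of the entropy at the vertex, for the head or the tail.\<close>
  have edge: "S' A (k *\<^sub>R (lam1 A *\<^sub>R P + Q)) = - (sound A * k) * S' A P"
    if "admissible A" "ten_moment_jet (deriv W 0) A P Q" for A P Q k
    unfolding linear_add[OF linear[OF that(1)]] linear_scale[OF linear[OF that(1)]] transported[OF that]
    by (simp add: lam1_def algebra_simps)
  obtain CL where CL: "ten_moment_jet (deriv W 0) VL VL' CL" "F (0, lam1 VL) = VL"
    "pd1 F (0, lam1 VL) = pd1 Y (0, lam1 VL) *\<^sub>R (lam1 VL *\<^sub>R VL' + CL)"
    by (rule head_derivative)
  note tail = tail_derivative[OF lim]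
  define tL where "tL = pd1 Y (0, lam1 VL)"
  define ts where "ts = pd1 Y (0, lam1 Vs)"
  have k: "sound Vs * ts = sound VL * tL"
    using fan.sound_times_time_scale unfolding tail(1) CL(2) tL_def ts_def .
  have "S' Vs (ts *\<^sub>R (lam1 Vs *\<^sub>R B + C)) * ts = S' VL (tL *\<^sub>R (lam1 VL *\<^sub>R VL' + CL)) * tL"
    using fan.entropy_times_time_scale[OF ent inv smooth(2) open_regions(2)]
    unfolding tail CL(2,3) tL_def ts_def .
  then have "(sound VL * tL) * (S' Vs B * ts) = (sound VL * tL) * (S' VL VL' * tL)"
    unfolding edge[OF admissible_Vs jet] edge[OF states(1) CL(1)] k by (simp add: algebra_simps)
  moreover have "tL \<noteq> 0" "ts \<noteq> 0"
    using fan.nondegenerate[of "(0, lam1 VL)"] fan.nondegenerate[of "(0, lam1 Vs)"] fan.ranges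
    by (auto simp: tL_def ts_def)
  moreover have c: "sound VL > 0" "sound Vs > 0" using sound_pos states(1) admissible_Vs by auto
  ultimately have "S' Vs B * ts = S' VL VL' * tL" by simp
  then have "S' Vs B * (sound VL * tL) = S' VL VL' * sound Vs * tL"
    using k by (metis mult.assoc mult.commute)
  then show ?thesis using \<open>tL \<noteq> 0\<close> c by (simp add: field_simps)
qed

lemma starL_derivative_limits:
  assumes lim: "(V \<longlongrightarrow> Vs) (at 0 within starL_region)"
    "(pd1 V \<longlongrightarrow> B) (at 0 within starL_region)" "(pd2 V \<longlongrightarrow> C) (at 0 within starL_region)"
  shows "((\<lambda>z. pd2 (\<lambda>y. V y $ i) z) \<longlongrightarrow> C $ i) (at 0 within starL_region)"
    and "(material V (\<lambda>y. V y $ i) \<longlongrightarrow> C $ i + u1 Vs * B $ i) (at 0 within starL_region)"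
proof -
  have sol: "smooth_solution W V starL_region" using smooth(3)[of 0] waves by simp
  note reg = smooth_region[OF sol open_regions(3)]
  have ev: "\<forall>\<^sub>F z in at 0 within starL_region. z \<in> starL_region"
    by (simp add: eventually_at_filter)
  have c: "((\<lambda>z. pd2 V z $ i) \<longlongrightarrow> C $ i) (at 0 within starL_region)"
    by (intro tendsto_intros lim)
  show "((\<lambda>z. pd2 (\<lambda>y. V y $ i) z) \<longlongrightarrow> C $ i) (at 0 within starL_region)"
    by (rule Lim_transform_eventually[OF c eventually_mono[OF ev]]) (simp add: pd_vec_nth(2)[OF reg(1)])
  have m: "((\<lambda>z. pd2 V z $ i + u1 (V z) * pd1 V z $ i) \<longlongrightarrow> C $ i + u1 Vs * B $ i) (at 0 within starL_region)"
    by (intro tendsto_intros lim)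
  show "(material V (\<lambda>y. V y $ i) \<longlongrightarrow> C $ i + u1 Vs * B $ i) (at 0 within starL_region)"
    by (rule Lim_transform_eventually[OF m eventually_mono[OF ev]])
       (simp add: material_def pd_vec_nth[OF reg(1)])
qed

text \<open>The limit is taken on the chain-rule expression, since the chain rule holds in the region but not at the origin.\<close>

lemma starL_invariant_limit:
  assumes S: "\<And>v. admissible v \<Longrightarrow> (S has_derivative S' v) (at v)"
    and L: "((\<lambda>z. S' (V z) (pd2 V z)) \<longlongrightarrow> l) (at 0 within starL_region)"
  shows "(pd2 (\<lambda>y. S (V y)) \<longlongrightarrow> l) (at 0 within starL_region)"
proof (rule Lim_transform_eventually[OF L])
  have sol: "smooth_solution W V starL_region" using smooth(3)[of 0] waves by simp
  note reg = smooth_region[OF sol open_regions(3)]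
  have "pd2 (\<lambda>y. S (V y)) z = S' (V z) (pd2 V z)" if "z \<in> starL_region" for z
    by (rule pd_compose(2)[OF reg(1)[OF that] S[OF reg(3)[OF that]]])
  then show "\<forall>\<^sub>F z in at 0 within starL_region. S' (V z) (pd2 V z) = pd2 (\<lambda>y. S (V y)) z"
    by (simp add: eventually_at_filter)
qed

end

theorem theorem5p10:
  fixes W :: "real \<Rightarrow> real"
    and V :: "real \<times> real \<Rightarrow> state"
    and VL VL' VR VR' Vs :: state
    and r T \<alpha>0 :: real
    and n :: nat
    and \<eta> \<zeta> :: "real \<Rightarrow> real"
    and \<gamma> :: "nat \<Rightarrow> real \<Rightarrow> real"
    and X Y :: "real \<times> real \<Rightarrow> real"
    and F :: "real \<times> real \<Rightarrow> state"
    and starL :: "(real \<times> real) set"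
    and Du1 Du2 Dp11 Dp12 rho_t p11_t A3 B3 D3 A4 B4 D4 :: real
  assumes solution: "grp_solution W V VL VL' VR VR' r T n \<eta> \<gamma> \<zeta>"
    and starL: "starL = wave_region T (\<gamma> 0) (\<gamma> 1)"
    and Vs: "Vs = lim0 starL V"
    and rarefaction: "rarefaction_fan V VL (lam1 VL) (lam1 Vs) r T \<eta> (\<gamma> 0) (\<gamma> 1) \<alpha>0 X Y F"
    and moves_left: "lam1 Vs < 0"
    and nonsonic: "\<And>t. 0 < t \<Longrightarrow> t < T \<Longrightarrow> \<gamma> 0 t < 0 \<and> 0 < \<gamma> n t"
    and Du1: "Du1 = lim0 starL (material V (\<lambda>z. u1 (V z)))"
    and Du2: "Du2 = lim0 starL (material V (\<lambda>z. u2 (V z)))"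
    and Dp11: "Dp11 = lim0 starL (material V (\<lambda>z. p11 (V z)))"
    and Dp12: "Dp12 = lim0 starL (material V (\<lambda>z. p12 (V z)))"
    and rho_t: "rho_t = lim0 starL (pd2 (\<lambda>z. rho (V z)))"
    and p11_t: "p11_t = lim0 starL (pd2 (\<lambda>z. p11 (V z)))"
    and quadrature2:
      "lim0 starL (pd2 (\<lambda>z. psi2 (V z))) =
         (kappa2 VL VL' + Pi2 VL VL' / (8 * sound VL) * (lam1 Vs - lam1 VL)) * psi1 VL
         + qL VL Vs / (2 * sound Vs) * lim0 starL (\<lambda>z. Pi2 (V z) (pd1 V z))"
    and quadrature3:
      "lim0 starL (pd2 (\<lambda>z. psi3 (V z))) =
         (kappa3 VL VL' + Pi3 VL VL' / (8 * sound VL) * (lam1 Vs - lam1 VL)) * psi1 VL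
         + qL VL Vs / (2 * sound Vs) * lim0 starL (\<lambda>z. Pi3 (V z) (pd1 V z))"
    and A3: "A3 = a3 VL Vs"
    and B3: "B3 = b3 Vs"
    and D3: "D3 = d3 VL VL' Vs (deriv W 0) Du1 Dp11 rho_t p11_t"
    and A4: "A4 = a4 VL Vs"
    and B4: "B4 = b4 VL Vs"
    and D4: "D4 = d4 VL VL' Vs (deriv W 0) Du1 Dp11 rho_t"
    and nondegenerate: "A3 * B4 - A4 * B3 \<noteq> 0"
  shows "Du2 = (D3 * B4 - D4 * B3) / (A3 * B4 - A4 * B3) \<and>
         Dp12 = (D3 * A4 - D4 * A3) / (B3 * A4 - B4 * A3) \<and>
         lim0 starL (pd2 (\<lambda>z. u2 (V z))) =
           Du2 + u1 Vs / p11 Vs * (Dp12 - 2 * p12 Vs / (3 * p11 Vs) * Dp11) \<and>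
         lim0 starL (pd2 (\<lambda>z. p12 (V z))) = Dp12 + rho Vs * u1 Vs * Du2 \<and>
         lim0 starL (\<lambda>z. p11 (V z) / rho (V z) ^ 4 * pd2 (\<lambda>y. p22 (V y)) z) =
           - (S2_prime VL VL' / sound VL) * sound Vs * u1 Vs
           - lim0 starL (\<lambda>z. p22 (V z) / rho (V z) ^ 4 * pd2 (\<lambda>y. p11 (V y)) z)
           + lim0 starL (\<lambda>z. 2 * p12 (V z) / rho (V z) ^ 4 * pd2 (\<lambda>y. p12 (V y)) z)
           + lim0 starL (\<lambda>z. 4 * detp (V z) / rho (V z) ^ 5 * pd2 (\<lambda>y. rho (V y)) z)"
proof -
  interpret grp_with_fan W V VL VL' VR VR' r T n \<eta> \<gamma> \<zeta> Vs \<alpha>0 X Y F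
    using solution rarefaction Vs starL by (simp add: grp_with_fan_def grp_with_fan_axioms_def)
  obtain B C where lim: "(V \<longlongrightarrow> Vs) (at 0 within starL_region)"
    "(pd1 V \<longlongrightarrow> B) (at 0 within starL_region)" "(pd2 V \<longlongrightarrow> C) (at 0 within starL_region)"
    and jet: "ten_moment_jet (deriv W 0) Vs B C"
    by (rule starL_limits)
  have r: "rho Vs \<noteq> 0" "p11 Vs \<noteq> 0" "rho Vs * p11 Vs > 0"
    using admissible_Vs by (auto simp: admissible_def)
  note comp = lim[THEN tendsto_vec_nth] starL_derivative_limits(1)[OF lim]
  note tends = comp tendsto_const tendsto_add tendsto_diff tendsto_mult tendsto_divide tendsto_power tendsto_real_sqrt
  note limits = lim0_starL[OF starL_derivative_limits(1)[OF lim]] lim0_starL[OF starL_derivative_limits(2)[OF lim]]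
  have sound_lim: "((\<lambda>z. sound (V z)) \<longlongrightarrow> sound Vs) (at 0 within starL_region)"
    unfolding sound_def by (intro tends) (use r in auto)
  have "(pd2 (\<lambda>z. psi2 (V z)) \<longlongrightarrow> psi2_prime Vs C) (at 0 within starL_region)"
    unfolding psi2_prime_def
    by (intro starL_invariant_limit[OF psi2_has_derivative, unfolded psi2_prime_def] tends)
       (use r in auto)
  moreover have "((\<lambda>z. Pi2 (V z) (pd1 V z)) \<longlongrightarrow> Pi2 Vs B) (at 0 within starL_region)"
    unfolding Pi2_def by (intro tends) (use r in auto)
  ultimately have q2: "psi2_prime Vs C = (kappa2 VL VL' + Pi2 VL VL' / (8 * sound VL) * (lam1 Vs - lam1 VL)) * psi1 VL
         + qL VL Vs / (2 * sound Vs) * Pi2 Vs B"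
    using quadrature2 lim0_starL unfolding starL by metis
  have "(pd2 (\<lambda>z. psi3 (V z)) \<longlongrightarrow> psi3_prime Vs C) (at 0 within starL_region)"
    unfolding psi3_prime_def
    by (intro starL_invariant_limit[OF psi3_has_derivative, unfolded psi3_prime_def] tends)
       (use r in auto)
  moreover have "((\<lambda>z. Pi3 (V z) (pd1 V z)) \<longlongrightarrow> Pi3 Vs B) (at 0 within starL_region)"
    unfolding Pi3_def by (intro tends sound_lim) (use r in auto)
  ultimately have q3: "psi3_prime Vs C = (kappa3 VL VL' + Pi3 VL VL' / (8 * sound VL) * (lam1 Vs - lam1 VL)) * psi1 VL
         + qL VL Vs / (2 * sound Vs) * Pi3 Vs B"
    using quadrature3 lim0_starL unfolding starL by metis
  have S1: "S1_prime Vs B = S1_prime VL VL' / sound VL * sound Vs"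
    by (rule entropy_derivative_across_fan[OF entropy_S1 _ lim jet]) simp
  have S2: "S2_prime Vs B = S2_prime VL VL' / sound VL * sound Vs"
    by (rule entropy_derivative_across_fan[OF entropy_S2 _ lim jet]) simp
  note D = Du1[unfolded starL limits] Du2[unfolded starL limits] Dp11[unfolded starL limits]
    Dp12[unfolded starL limits]
  have t: "rho_t = rho C" "p11_t = p11 C"
    using rho_t p11_t limits(1) unfolding starL by auto
  have "A3 * Du2 + B3 * Dp12 = D3"
    unfolding A3 B3 D3 t by (rule psi2_quadrature_coefficients[OF admissible_Vs jet S1 D q2])
  moreover have "A4 * Du2 + B4 * Dp12 = D4"
    unfolding A4 B4 D4 t by (rule psi3_quadrature_coefficients[OF admissible_Vs jet S1 D q3])
  ultimately have "Du2 = (D3 * B4 - D4 * B3) / (A3 * B4 - A4 * B3)"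
    "Dp12 = (D3 * A4 - D4 * A3) / (B3 * A4 - B4 * A3)"
    by (rule cramer_2[OF _ _ nondegenerate])+
  moreover have "lim0 starL (pd2 (\<lambda>z. u2 (V z))) =
           Du2 + u1 Vs / p11 Vs * (Dp12 - 2 * p12 Vs / (3 * p11 Vs) * Dp11)"
    "lim0 starL (pd2 (\<lambda>z. p12 (V z))) = Dp12 + rho Vs * u1 Vs * Du2"
    unfolding starL limits D by (rule jet_t_derivatives[OF admissible_Vs jet])+
  moreover have "lim0 starL (\<lambda>z. p11 (V z) / rho (V z) ^ 4 * pd2 (\<lambda>y. p22 (V y)) z) = p11 Vs / rho Vs ^ 4 * p22 C"
    "lim0 starL (\<lambda>z. p22 (V z) / rho (V z) ^ 4 * pd2 (\<lambda>y. p11 (V y)) z) = p22 Vs / rho Vs ^ 4 * p11 C"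
    "lim0 starL (\<lambda>z. 2 * p12 (V z) / rho (V z) ^ 4 * pd2 (\<lambda>y. p12 (V y)) z) = 2 * p12 Vs / rho Vs ^ 4 * p12 C"
    "lim0 starL (\<lambda>z. 4 * detp (V z) / rho (V z) ^ 5 * pd2 (\<lambda>y. rho (V y)) z) = 4 * detp Vs / rho Vs ^ 5 * rho C"
    unfolding starL detp_def by (rule lim0_starL, intro tends; use r in simp)+
  moreover have "S2_prime Vs C = - (S2_prime VL VL' / sound VL) * sound Vs * u1 Vs"
    using entropy.transported[OF entropy_S2 admissible_Vs jet] S2 by simp
  then have "p11 Vs / rho Vs ^ 4 * p22 C = - (S2_prime VL VL' / sound VL) * sound Vs * u1 Vs
     - p22 Vs / rho Vs ^ 4 * p11 C + 2 * p12 Vs / rho Vs ^ 4 * p12 C + 4 * detp Vs / rho Vs ^ 5 * rho C"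
    unfolding S2_prime_def[of Vs C] by linarith
  ultimately show ?thesis by simp
qed

end
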